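(* Let $G$ be an infinite virtually cyclic group. Then the full box space $\square G$ is coarsely equivalent to the full box space $\square\mathbb{Z}$ of $\mathbb{Z}$, i.e. to the coarse disjoint union of all cycles $C_n$, $n\ge 1$.
   Context: A map $f:X\to Y$ of metric spaces is a coarse embedding if for all sequences $(x_n),(y_n)$ in $X$: $d_X(x_n,y_n)\to+\infty \iff d_Y(f(x_n),f(y_n))\to +\infty$. It is a coarse equivalence if moreover there is $R\ge 0$ such that $Y$ is the $R$-neighbourhood of $f(X)$. Full box space: for a finitely generated residually finite group $G$ with a fixed finite generating set $S$, $\square G=\coprod_{N\triangleleft G,\,[G:N]<\infty}G/N$ (one component for each finite index normal subgroup $N$). Each $G/N$ carries the word metric from the image of $S$, and $\square G$ is endowed with a metric inducing these metrics on components and such that the distance between two different components is at least the maximum of their diameters (coarse disjoint union). It is well-defined up to coarse equivalence. $C_n$ denotes the cycle graph with $n$ vertices. *)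

theory Defs
  imports "HOL-Algebra.Elementary_Groups" "HOL-Analysis.Analysis"
begin

definition coarse_embedding :: "'a metric \<Rightarrow> 'b metric \<Rightarrow> ('a \<Rightarrow> 'b) \<Rightarrow> bool" where
  "coarse_embedding X Y f \<longleftrightarrow>
     f \<in> mspace X \<rightarrow> mspace Y \<and>
     (\<forall>x y :: nat \<Rightarrow> 'a. range x \<subseteq> mspace X \<and> range y \<subseteq> mspace X \<longrightarrow>
        (filterlim (\<lambda>n. mdist X (x n) (y n)) at_top sequentially \<longleftrightarrow>
         filterlim (\<lambda>n. mdist Y (f (x n)) (f (y n))) at_top sequentially))"

definition coarse_equivalence :: "'a metric \<Rightarrow> 'b metric \<Rightarrow> ('a \<Rightarrow> 'b) \<Rightarrow> bool" where
  "coarse_equivalence X Y f \<longleftrightarrow>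
     coarse_embedding X Y f \<and>
     (\<exists>R\<ge>0. \<forall>y\<in>mspace Y. \<exists>x\<in>mspace X. mdist Y y (f x) \<le> R)"

definition coarsely_equivalent :: "'a metric \<Rightarrow> 'b metric \<Rightarrow> bool" where
  "coarsely_equivalent X Y \<longleftrightarrow> (\<exists>f. coarse_equivalence X Y f)"

definition diam :: "'a set \<Rightarrow> ('a \<Rightarrow> 'a \<Rightarrow> real) \<Rightarrow> real" where
  "diam X d = Sup {d x y | x y. x \<in> X \<and> y \<in> X}"

text \<open>
  The requirements determine the metric only up to coarse equivalence, hence a predicate on
  metrics. The bound on the distance between two components is stated pointwise; it is meant for
  families of finite nonempty components.
\<close>

definition coarse_disjoint_union ::
    "'i set \<Rightarrow> ('i \<Rightarrow> 'a set) \<Rightarrow> ('i \<Rightarrow> 'a \<Rightarrow> 'a \<Rightarrow> real) \<Rightarrow> ('i \<times> 'a) metric \<Rightarrow> bool" where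
  "coarse_disjoint_union I X d Z \<longleftrightarrow>
     mspace Z = Sigma I X \<and>
     (\<forall>i\<in>I. \<forall>x\<in>X i. \<forall>y\<in>X i. mdist Z (i, x) (i, y) = d i x y) \<and>
     (\<forall>i\<in>I. \<forall>j\<in>I. i \<noteq> j \<longrightarrow>
        (\<forall>x\<in>X i. \<forall>y\<in>X j. max (diam (X i) (d i)) (diam (X j) (d j)) \<le> mdist Z (i, x) (j, y)))"

definition finite_generating_set :: "('a, 'b) monoid_scheme \<Rightarrow> 'a set \<Rightarrow> bool" where
  "finite_generating_set G S \<longleftrightarrow> finite S \<and> S \<subseteq> carrier G \<and> generate G S = carrier G"

definition word_length :: "('a, 'b) monoid_scheme \<Rightarrow> 'a set \<Rightarrow> 'a \<Rightarrow> nat" where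
  "word_length G S g =
     (LEAST n. \<exists>ws. set ws \<subseteq> S \<union> (\<lambda>s. inv\<^bsub>G\<^esub> s) ` S \<and> length ws = n \<and>
        foldr (\<lambda>a b. a \<otimes>\<^bsub>G\<^esub> b) ws \<one>\<^bsub>G\<^esub> = g)"

definition word_metric :: "('a, 'b) monoid_scheme \<Rightarrow> 'a set \<Rightarrow> 'a \<Rightarrow> 'a \<Rightarrow> real" where
  "word_metric G S g h = real (word_length G S (inv\<^bsub>G\<^esub> g \<otimes>\<^bsub>G\<^esub> h))"

definition finite_index_normal_subgroups :: "('a, 'b) monoid_scheme \<Rightarrow> 'a set set" where
  "finite_index_normal_subgroups G = {N. N \<lhd> G \<and> finite (rcosets\<^bsub>G\<^esub> N)}"

definition full_box_space ::
    "('a, 'b) monoid_scheme \<Rightarrow> 'a set \<Rightarrow> ('a set \<times> 'a set) metric \<Rightarrow> bool" where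
  "full_box_space G S Z \<longleftrightarrow>
     coarse_disjoint_union (finite_index_normal_subgroups G) (\<lambda>N. carrier (G Mod N))
       (\<lambda>N. word_metric (G Mod N) ((\<lambda>s. N #>\<^bsub>G\<^esub> s) ` S)) Z"

definition graph_dist :: "('v \<times> 'v) set \<Rightarrow> 'v \<Rightarrow> 'v \<Rightarrow> real" where
  "graph_dist E x y = real (LEAST k. (x, y) \<in> E ^^ k)"

text \<open>For \<open>n = 1\<close> this has a loop, which does not affect distances; for \<open>n = 2\<close> it is a single edge.\<close>

definition cycle_edges :: "nat \<Rightarrow> (nat \<times> nat) set" where
  "cycle_edges n = {(i, j). i < n \<and> j < n \<and> (j = Suc i mod n \<or> i = Suc j mod n)}"

definition union_of_cycles :: "(nat \<times> nat) metric \<Rightarrow> bool" where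
  "union_of_cycles Z \<longleftrightarrow>
     coarse_disjoint_union {1..} (\<lambda>n. {..<n}) (\<lambda>n. graph_dist (cycle_edges n)) Z"

definition virtually_cyclic :: "('a, 'b) monoid_scheme \<Rightarrow> bool" where
  "virtually_cyclic G \<longleftrightarrow>
     (\<exists>H. subgroup H G \<and> finite (rcosets\<^bsub>G\<^esub> H) \<and> cyclic_group (G\<lparr>carrier := H\<rparr>))"

end

theory Submission
  imports Defs "HOL-Algebra.Multiplicative_Group"
begin

text \<open>
  A virtually infinite cyclic group \<open>G\<close> contains a normal infinite cyclic subgroup \<open>\<langle>a\<rangle>\<close> of finite
  index. Twisting the transfer to \<open>\<langle>a\<rangle>\<close> by the sign \<open>e\<close> of the conjugation action on \<open>a\<close> gives a cocycle
  \<open>psi\<close>, that is, an action of \<open>G\<close> by isometries of the integers with finite stabilizers. If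
  \<open>N\<close> is normal of finite index and \<open>k\<close> is the smallest positive translation length in \<open>N\<close>, then
  \<open>psi\<close> modulo \<open>k\<close> is a quasi-isometry from \<open>G/N\<close> to the cycle \<open>C\<^sub>k\<close>, with constants independent of
  \<open>N\<close>. A given \<open>k\<close> occurs for boundedly many \<open>N\<close>, and every multiple of the translation length of \<open>a\<close>
  occurs. Ranking the \<open>N\<close> by \<open>k\<close> hence gives a bijection \<open>b\<close> onto the positive integers such that
  \<open>b N / k\<close> is bounded above and away from \<open>0\<close>, and rescaling \<open>C\<^sub>k\<close> to the cycle of length \<open>b N\<close> identifies the
  box space with the union of all cycles.
\<close>

section \<open>Cycles\<close>

text \<open>The sign twist is what admits reflections: the infinite dihedral group has no nonzero
  homomorphism to the integers, so the plain transfer would vanish there. Its price is that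
  \<open>psi\<close> modulo \<open>k\<close> is constant on cosets only as long as \<open>N\<close>
  contains no reflection. But a reflection in \<open>N\<close> forces \<open>k \<le> 2 * m\<close>,
  so that the whole cycle has radius at most \<open>m\<close> and the ambiguity is bounded after
  all. The same dichotomy bounds the number of \<open>N\<close> with given \<open>k\<close>: such an
  \<open>N\<close> is determined by its elements with \<open>psi\<close> equal to \<open>k\<close>
  or in \<open>[0, 2m]\<close>, and the number of group elements in this window is bounded
  independently of \<open>k\<close>. Sending \<open>N\<close> to the cycle of length
  \<open>k\<close> itself would not do, since several \<open>N\<close> may share \<open>k\<close>
  while some lengths may not occur at all. For the ranking, bounded multiplicity keeps
  \<open>b N\<close> from outgrowing \<open>k\<close>, and the occurrence of all multiples keeps it
  from falling behind. The integers get no separate treatment: they are one more group to which the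
  argument applies.\<close>

definition circ :: "int \<Rightarrow> int \<Rightarrow> int" where
  "circ n z = min (z mod n) ((- z) mod n)"

lemma circ_nonneg: "n > 0 \<Longrightarrow> 0 \<le> circ n z"
  by (simp add: circ_def)

lemma circ_minus: "circ n (- z) = circ n z"
  by (simp add: circ_def min.commute)

lemma circ_diff_commute: "circ n (x - y) = circ n (y - x)"
  using circ_minus[of n "x - y"] by simp

lemma circ_add_mult: "circ n (z + n * q) = circ n z"
proof -
  have "(- (z + n * q)) mod n = (- z) mod n"
    using mod_mult_self2[of "- z" n "- q"] by (simp add: algebra_simps)
  then show ?thesis
    by (simp add: circ_def)
qed

lemma circ_cong: "z mod n = w mod n \<Longrightarrow> circ n z = circ n w"
  by (simp add: circ_def) (metis mod_minus_cong)

lemma circ_le_abs: "n > 0 \<Longrightarrow> circ n z \<le> \<bar>z\<bar>"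
  using zmod_le_nonneg_dividend[of z n] zmod_le_nonneg_dividend[of "- z" n]
  by (cases "z \<ge> 0") (auto simp: circ_def)

lemma circ_le: "n > 0 \<Longrightarrow> circ n z \<le> n div 2"
proof -
  assume n: "n > 0"
  show ?thesis
  proof (cases "z mod n = 0")
    case True
    then show ?thesis using n by (simp add: circ_def)
  next
    case False
    then have "(- z) mod n = n - z mod n"
      by (simp add: zmod_zminus1_eq_if)
    then show ?thesis by (simp add: circ_def)
  qed
qed

text \<open>\<open>circ n z\<close> is the distance from \<open>z\<close> to the multiples of
  \<open>n\<close>. Fixing a nearest multiple turns statements modulo \<open>n\<close> into
  statements about integers, for the triangle inequality as well as for lifting from a
  quotient.\<close>

lemma circ_eq_abs:
  assumes "n > 0"
  obtains q where "circ n z = \<bar>z + n * q\<bar>"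
proof (cases "z mod n \<le> (- z) mod n")
  case True
  have "z mod n = z + n * (- (z div n))"
    by (simp add: minus_mult_div_eq_mod)
  moreover have "0 \<le> z mod n" using assms by simp
  ultimately show ?thesis using that[of "- (z div n)"] True by (simp add: circ_def)
next
  case False
  have "(- z) mod n = - (z + n * ((- z) div n))"
    using minus_mult_div_eq_mod[of "- z" n] by simp
  moreover have "0 \<le> (- z) mod n" using assms by simp
  ultimately show ?thesis using that[of "(- z) div n"] False by (simp add: circ_def)
qed

lemma circ_add_le:
  assumes n: "n > 0"
  shows "circ n (x + y) \<le> circ n x + circ n y"
proof -
  obtain p q where p: "circ n x = \<bar>x + n * p\<bar>" and q: "circ n y = \<bar>y + n * q\<bar>"
    using circ_eq_abs[OF n] by metis
  have "circ n (x + y) = circ n (x + n * p + (y + n * q))"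
    using circ_add_mult[of n "x + y" "p + q"] by (simp add: algebra_simps)
  also have "\<dots> \<le> \<bar>x + n * p + (y + n * q)\<bar>"
    using circ_le_abs[OF n] .
  finally show ?thesis using p q by linarith
qed

lemma circ_triangle: "n > 0 \<Longrightarrow> circ n (x - z) \<le> circ n (x - y) + circ n (y - z)"
  using circ_add_le[of n "x - y" "y - z"] by simp

lemma circ_diff_eq:
  assumes "0 \<le> x" "x < n" "0 \<le> y" "y < n"
  shows "circ n (x - y) = min \<bar>x - y\<bar> (n - \<bar>x - y\<bar>)"
proof -
  have *: "circ n z = min z (n - z)" if "0 \<le> z" "z < n" for z
  proof (cases "z = 0")
    case False
    then show ?thesis using that by (simp add: circ_def zmod_zminus1_eq_if)
  qed (use that in \<open>simp add: circ_def\<close>)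
  show ?thesis
  proof (cases "y \<le> x")
    case True
    then show ?thesis using *[of "x - y"] assms by simp
  next
    case False
    then show ?thesis using *[of "y - x"] assms circ_diff_commute[of n x y] by simp
  qed
qed

section \<open>The metric of a cycle as a graph distance\<close>

definition cycle_dist :: "nat \<Rightarrow> nat \<Rightarrow> nat \<Rightarrow> real" where
  "cycle_dist n x y = real_of_int (circ (int n) (int x - int y))"

lemma cycle_dist_commute: "cycle_dist n x y = cycle_dist n y x"
  by (simp add: cycle_dist_def circ_diff_commute)

lemma cycle_dist_triangle: "n > 0 \<Longrightarrow> cycle_dist n x z \<le> cycle_dist n x y + cycle_dist n y z"
  using circ_triangle[of "int n" "int x" "int z" "int y"] by (simp add: cycle_dist_def flip: of_int_add)

lemma cycle_dist_self: "cycle_dist n x x = 0"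
  by (simp add: cycle_dist_def circ_def)

lemma relpow_sym:
  assumes "sym R" "(x, y) \<in> R ^^ k"
  shows "(y, x) \<in> R ^^ k"
  using assms(2)
proof (induction k arbitrary: x)
  case (Suc k)
  then obtain z where "(x, z) \<in> R" "(z, y) \<in> R ^^ k"
    by (meson relpow_Suc_D2)
  then show ?case
    using Suc.IH assms(1) by (meson relpow_Suc_I symD)
qed simp

text \<open>Upper bound: one of the two forward arcs between \<open>x\<close> and \<open>y\<close>
  has length \<open>circ\<close>, and symmetry of the edges reverses it if necessary. Lower bound:
  \<open>circ\<close> changes by at most 1 along an edge.\<close>

lemma graph_dist_cycle_edges:
  assumes x: "x < n" and y: "y < n"
  shows "graph_dist (cycle_edges n) x y = cycle_dist n x y"
proof -
  let ?E = "cycle_edges n" and ?c = "nat (circ (int n) (int x - int y))"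
  have n: "int n > 0" using x by simp
  have s: "sym ?E" by (auto simp: cycle_edges_def sym_def)
  have path: "(u, (u + j) mod n) \<in> ?E ^^ j" if u: "u < n" for u j
  proof (induction j)
    case (Suc j)
    have "((u + j) mod n, (u + Suc j) mod n) \<in> ?E"
      using u by (simp add: cycle_edges_def mod_Suc_eq)
    with Suc show ?case by auto
  qed (use u in simp)
  have nice: "(u, v) \<in> ?E ^^ nat ((int v - int u) mod int n)" if "u < n" "v < n" for u v
  proof -
    have "int ((u + nat ((int v - int u) mod int n)) mod n) = int v"
      using n that by (simp add: zmod_int mod_add_right_eq)
    then show ?thesis
      using path[of u "nat ((int v - int u) mod int n)"] that by simp
  qed
  have reach: "(x, y) \<in> ?E ^^ ?c"
    using nice[OF x y] relpow_sym[OF s nice[OF y x]] by (simp add: circ_def min_def)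
  have edge: "circ (int n) (int u - int v) \<le> 1" if "(u, v) \<in> ?E" for u v
  proof -
    have *: "circ (int n) (int (Suc i mod n) - int i) \<le> 1" for i
    proof -
      have "(int (Suc i mod n) - int i) mod int n = 1 mod int n"
        by (simp add: zmod_int mod_diff_left_eq)
      then show ?thesis
        using circ_cong[of "int (Suc i mod n) - int i" "int n" 1] circ_le_abs[OF n, of 1] by simp
    qed
    show ?thesis
      using that *[of u] *[of v] circ_diff_commute[of "int n" "int u" "int v"]
      by (auto simp: cycle_edges_def)
  qed
  have lower: "circ (int n) (int u - int v) \<le> int k" if "(u, v) \<in> ?E ^^ k" for u v k
    using that
  proof (induction k arbitrary: v)
    case (Suc k)
    then obtain w where w: "(u, w) \<in> ?E ^^ k" "(w, v) \<in> ?E" by auto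
    show ?case
      using Suc.IH[OF w(1)] edge[OF w(2)] circ_triangle[OF n, of "int u" "int v" "int w"] by simp
  qed (simp add: circ_def)
  have "(LEAST k. (x, y) \<in> ?E ^^ k) = ?c"
  proof (rule Least_equality)
    show "?c \<le> k" if "(x, y) \<in> ?E ^^ k" for k
      using lower[OF that] by linarith
  qed (rule reach)
  then show ?thesis
    using circ_nonneg[OF n] by (simp add: graph_dist_def cycle_dist_def)
qed

section \<open>Coarse disjoint unions of families of cycles\<close>

text \<open>The hypotheses act crosswise, by contraposition: \<open>lo\<close> carries divergence
  from \<open>X\<close> to \<open>Y\<close>, and \<open>up\<close> carries it back.\<close>

lemma coarse_embeddingI:
  assumes f: "f \<in> mspace X \<rightarrow> mspace Y"
    and up: "\<And>R. \<exists>R'. \<forall>x\<in>mspace X. \<forall>y\<in>mspace X. mdist X x y \<le> R \<longrightarrow> mdist Y (f x) (f y) \<le> R'"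
    and lo: "\<And>R. \<exists>R'. \<forall>x\<in>mspace X. \<forall>y\<in>mspace X. mdist Y (f x) (f y) \<le> R \<longrightarrow> mdist X x y \<le> R'"
  shows "coarse_embedding X Y f"
proof -
  have aux: "filterlim v at_top sequentially"
    if u: "filterlim u at_top sequentially"
      and bd: "\<And>R. \<exists>R'. \<forall>n. v n \<le> R \<longrightarrow> u n \<le> R'" for u v :: "nat \<Rightarrow> real"
    unfolding filterlim_at_top
  proof
    fix R
    obtain R' where R': "\<forall>n. v n \<le> R \<longrightarrow> u n \<le> R'" using bd by blast
    have "\<forall>\<^sub>F n in sequentially. R' + 1 \<le> u n"
      using u unfolding filterlim_at_top by blast
    then show "\<forall>\<^sub>F n in sequentially. R \<le> v n"
    proof (rule eventually_mono)
      fix n assume "R' + 1 \<le> u n"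
      with R'[rule_format, of n] show "R \<le> v n" by linarith
    qed
  qed
  show ?thesis
    unfolding coarse_embedding_def
  proof (intro conjI allI impI f iffI)
    fix x y :: "nat \<Rightarrow> 'a"
    assume xy: "range x \<subseteq> mspace X \<and> range y \<subseteq> mspace X"
    have in_X: "x n \<in> mspace X" "y n \<in> mspace X" for n using xy by auto
    show "filterlim (\<lambda>n. mdist Y (f (x n)) (f (y n))) at_top sequentially"
      if "filterlim (\<lambda>n. mdist X (x n) (y n)) at_top sequentially"
      using that proof (rule aux)
      fix R obtain R' where "\<forall>x\<in>mspace X. \<forall>y\<in>mspace X. mdist Y (f x) (f y) \<le> R \<longrightarrow> mdist X x y \<le> R'"
        using lo by blast
      then show "\<exists>R'. \<forall>n. mdist Y (f (x n)) (f (y n)) \<le> R \<longrightarrow> mdist X (x n) (y n) \<le> R'"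
        using in_X by blast
    qed
    show "filterlim (\<lambda>n. mdist X (x n) (y n)) at_top sequentially"
      if "filterlim (\<lambda>n. mdist Y (f (x n)) (f (y n))) at_top sequentially"
      using that proof (rule aux)
      fix R obtain R' where "\<forall>x\<in>mspace X. \<forall>y\<in>mspace X. mdist X x y \<le> R \<longrightarrow> mdist Y (f x) (f y) \<le> R'"
        using up by blast
      then show "\<exists>R'. \<forall>n. mdist X (x n) (y n) \<le> R \<longrightarrow> mdist Y (f (x n)) (f (y n)) \<le> R'"
        using in_X by blast
    qed
  qed
qed

text \<open>The maps \<open>g i\<close> are quasi-isometries to cycles with one constant
  \<open>L\<close> for all components; this uniformity is what passes to the coarse union.
  Bijectivity of \<open>b\<close> lets any two such families be matched component by
  component.\<close>

definition cycle_family ::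
    "'i set \<Rightarrow> ('i \<Rightarrow> 'a set) \<Rightarrow> ('i \<Rightarrow> 'a \<Rightarrow> 'a \<Rightarrow> real) \<Rightarrow> ('i \<Rightarrow> nat) \<Rightarrow> ('i \<Rightarrow> 'a \<Rightarrow> nat)
      \<Rightarrow> real \<Rightarrow> bool" where
  "cycle_family I X d b g L \<longleftrightarrow> bij_betw b I {1..} \<and> L \<ge> 0 \<and>
     (\<forall>i\<in>I. finite (X i) \<and> X i \<noteq> {} \<and> g i \<in> X i \<rightarrow> {..<b i} \<and>
        (\<forall>x\<in>X i. \<forall>y\<in>X i. d i x y \<le> L * cycle_dist (b i) (g i x) (g i y) + L \<and>
                         cycle_dist (b i) (g i x) (g i y) \<le> L * d i x y + L) \<and>
        (\<forall>p<b i. \<exists>x\<in>X i. cycle_dist (b i) p (g i x) \<le> L))"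

lemma le_diam:
  assumes "finite X" "x \<in> X" "y \<in> X"
  shows "d x y \<le> diam X d"
proof -
  have "{d x y | x y. x \<in> X \<and> y \<in> X} = (\<lambda>(x, y). d x y) ` (X \<times> X)" by auto
  then have "bdd_above {d x y | x y. x \<in> X \<and> y \<in> X}"
    using assms(1) by simp
  then show ?thesis
    unfolding diam_def using assms by (intro cSup_upper) auto
qed

text \<open>Opposite points of a cycle are about \<open>b i / 2\<close> apart, and both are within
  \<open>L\<close> of the image of \<open>g i\<close>. So \<open>b i\<close> is bounded by an affine
  function of the diameter, and \<open>b\<close> is injective.\<close>

lemma cycle_family_finite_diam_le:
  assumes F: "cycle_family I X d b g L"
  shows "finite {i\<in>I. diam (X i) (d i) \<le> R}"
proof -
  have bij: "bij_betw b I {1..}" and L: "L \<ge> 0" using F by (auto simp: cycle_family_def)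
  have "b i \<le> nat \<lceil>2 * (L * R + 3 * L) + 2\<rceil>" if i: "i \<in> I" and D: "diam (X i) (d i) \<le> R" for i
  proof -
    have fin: "finite (X i)"
      and bd: "\<And>x y. x \<in> X i \<Longrightarrow> y \<in> X i \<Longrightarrow> cycle_dist (b i) (g i x) (g i y) \<le> L * d i x y + L"
      and dense: "\<And>p. p < b i \<Longrightarrow> \<exists>x\<in>X i. cycle_dist (b i) p (g i x) \<le> L"
      using F i by (auto simp: cycle_family_def)
    have pos: "b i > 0" using bij_betwE[OF bij] i by force
    obtain x y where x: "x \<in> X i" "cycle_dist (b i) 0 (g i x) \<le> L"
      and y: "y \<in> X i" "cycle_dist (b i) (b i div 2) (g i y) \<le> L"
      using dense[of 0] dense[of "b i div 2"] pos by auto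
    \<comment> \<open>The loss of 1 accounts for odd lengths, where \<open>b i div 2\<close> rounds
      down.\<close>
    have "real (b i) - 1 \<le> 2 * cycle_dist (b i) 0 (b i div 2)"
      using pos unfolding cycle_dist_def
      by (subst circ_diff_eq) (auto simp: min_def)
    moreover have "cycle_dist (b i) 0 (b i div 2) \<le> L + (L * d i x y + L) + L"
      using cycle_dist_triangle[OF pos, of 0 "b i div 2" "g i x"]
        cycle_dist_triangle[OF pos, of "g i x" "b i div 2" "g i y"]
        cycle_dist_commute[of "b i" "g i y" "b i div 2"] x y bd[OF x(1) y(1)] by linarith
    moreover have "L * d i x y \<le> L * R"
      using le_diam[OF fin x(1) y(1), of "d i"] D L by (intro mult_left_mono) auto
    ultimately have "real (b i) \<le> 2 * (L * R + 3 * L) + 2" by argo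
    then show ?thesis by linarith
  qed
  then have "b ` {i\<in>I. diam (X i) (d i) \<le> R} \<subseteq> {..nat \<lceil>2 * (L * R + 3 * L) + 2\<rceil>}" by auto
  then have "finite (b ` {i\<in>I. diam (X i) (d i) \<le> R})" by (rule finite_subset) simp
  then show ?thesis
    by (rule finite_imageD) (use bij in \<open>auto simp: bij_betw_def inj_on_def\<close>)
qed

text \<open>Two points of different components at distance at most \<open>R\<close> lie in components of diameter at
  most \<open>R\<close>, of which there are finitely many: such pairs do not matter on the coarse scale.\<close>

lemma coarse_disjoint_union_map:
  assumes Z: "coarse_disjoint_union I X d Z" and W: "coarse_disjoint_union J Y e W"
    and f: "f \<in> mspace Z \<rightarrow> mspace W"
    and fin: "\<And>R. finite {i\<in>I. diam (X i) (d i) \<le> R}" "\<And>i. i \<in> I \<Longrightarrow> finite (X i)"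
    and same: "\<And>i x y. i \<in> I \<Longrightarrow> x \<in> X i \<Longrightarrow> y \<in> X i \<Longrightarrow>
      mdist W (f (i, x)) (f (i, y)) \<le> K * d i x y + K" "K \<ge> 0"
  shows "\<exists>R'. \<forall>p\<in>mspace Z. \<forall>q\<in>mspace Z. mdist Z p q \<le> R \<longrightarrow> mdist W (f p) (f q) \<le> R'"
proof -
  define A where "A = Sigma {i\<in>I. diam (X i) (d i) \<le> R} X"
  have sp: "mspace Z = Sigma I X" using Z by (simp add: coarse_disjoint_union_def)
  have "finite A" unfolding A_def using fin by (intro finite_SigmaI) auto
  then obtain B where B: "\<And>p q. p \<in> A \<Longrightarrow> q \<in> A \<Longrightarrow> mdist W (f p) (f q) \<le> B"
    using bdd_above_finite[of "(\<lambda>(p, q). mdist W (f p) (f q)) ` (A \<times> A)"]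
    by (fastforce simp: bdd_above_def)
  have "mdist W (f p) (f q) \<le> max B (K * R + K)"
    if p: "p \<in> mspace Z" and q: "q \<in> mspace Z" and le: "mdist Z p q \<le> R" for p q
  proof -
    obtain i x j y where pq: "p = (i, x)" "q = (j, y)" "i \<in> I" "j \<in> I" "x \<in> X i" "y \<in> X j"
      using p q sp by auto
    show ?thesis
    proof (cases "i = j")
      case True
      have "d i x y \<le> R" using Z pq True le by (auto simp: coarse_disjoint_union_def)
      then have "K * d i x y \<le> K * R" using \<open>K \<ge> 0\<close> by (rule mult_left_mono)
      then show ?thesis using same(1)[of i x y] pq True by force
    next
      case False
      then have "max (diam (X i) (d i)) (diam (X j) (d j)) \<le> mdist Z p q"
        using Z pq by (auto simp: coarse_disjoint_union_def)
      then have "p \<in> A" "q \<in> A" using le pq by (auto simp: A_def)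
      then show ?thesis using B by fastforce
    qed
  qed
  then show ?thesis by blast
qed

text \<open>Coarse unions are compared through the cycle with the same number \<open>b i = b' j\<close>.\<close>

lemma coarsely_equivalent_cycle_families:
  assumes F: "cycle_family I X d b g L" and F': "cycle_family J Y e b' g' L'"
    and Z: "coarse_disjoint_union I X d Z" and W: "coarse_disjoint_union J Y e W"
  shows "coarsely_equivalent Z W"
proof -
  have bij: "bij_betw b I {1..}" "bij_betw b' J {1..}" and L: "L \<ge> 0" "L' \<ge> 0"
    using F F' by (auto simp: cycle_family_def)
  define \<beta> where "\<beta> i = inv_into J b' (b i)" for i
  have \<beta>: "bij_betw \<beta> I J"
    using bij_betw_trans[OF bij(1) bij_betw_inv_into[OF bij(2)]] unfolding \<beta>_def comp_def .
  have \<beta>J: "\<beta> i \<in> J" if "i \<in> I" for i using bij_betwE[OF \<beta>] that by blast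
  have b\<beta>: "b' (\<beta> i) = b i" if "i \<in> I" for i
    using bij that unfolding \<beta>_def by (auto simp: bij_betw_def intro!: f_inv_into_f)
  have pos: "b i > 0" if "i \<in> I" for i using bij_betwE[OF bij(1)] that by force
  \<comment> \<open>\<open>g\<close> followed by a coarse inverse of \<open>g'\<close>; a point
    within \<open>L'\<close> exists because the image of \<open>g'\<close> is dense at that
    scale.\<close>
  define h where "h i x = (SOME y. y \<in> Y (\<beta> i) \<and> cycle_dist (b i) (g i x) (g' (\<beta> i) y) \<le> L')" for i x
  have h: "h i x \<in> Y (\<beta> i)" "cycle_dist (b i) (g i x) (g' (\<beta> i) (h i x)) \<le> L'"
    if "i \<in> I" "x \<in> X i" for i x
  proof -
    have "g i x < b' (\<beta> i)" using F that b\<beta> by (auto simp: cycle_family_def)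
    then have "\<exists>y. y \<in> Y (\<beta> i) \<and> cycle_dist (b i) (g i x) (g' (\<beta> i) y) \<le> L'"
      using F' \<beta>J b\<beta> that unfolding cycle_family_def by metis
    from someI_ex[OF this]
    show "h i x \<in> Y (\<beta> i)" "cycle_dist (b i) (g i x) (g' (\<beta> i) (h i x)) \<le> L'"
      unfolding h_def by auto
  qed
  define f where "f = (\<lambda>(i, x). (\<beta> i, h i x))"
  have sp: "mspace Z = Sigma I X" "mspace W = Sigma J Y"
    using Z W by (auto simp: coarse_disjoint_union_def)
  have f: "f \<in> mspace Z \<rightarrow> mspace W"
    using h \<beta>J by (auto simp: f_def sp)
  have FI: "finite (X i)"
      "\<And>x y. x \<in> X i \<Longrightarrow> y \<in> X i \<Longrightarrow> d i x y \<le> L * cycle_dist (b i) (g i x) (g i y) + L"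
      "\<And>x y. x \<in> X i \<Longrightarrow> y \<in> X i \<Longrightarrow> cycle_dist (b i) (g i x) (g i y) \<le> L * d i x y + L"
      "\<And>p. p < b i \<Longrightarrow> \<exists>x\<in>X i. cycle_dist (b i) p (g i x) \<le> L" if "i \<in> I" for i
    using F that by (auto simp: cycle_family_def)
  have FJ: "finite (Y (\<beta> i))"
      "\<And>x y. x \<in> Y (\<beta> i) \<Longrightarrow> y \<in> Y (\<beta> i) \<Longrightarrow>
        e (\<beta> i) x y \<le> L' * cycle_dist (b i) (g' (\<beta> i) x) (g' (\<beta> i) y) + L'"
      "\<And>x y. x \<in> Y (\<beta> i) \<Longrightarrow> y \<in> Y (\<beta> i) \<Longrightarrow>
        cycle_dist (b i) (g' (\<beta> i) x) (g' (\<beta> i) y) \<le> L' * e (\<beta> i) x y + L'"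
      "\<And>y. y \<in> Y (\<beta> i) \<Longrightarrow> g' (\<beta> i) y < b i" if "i \<in> I" for i
    using bspec[OF conjunct2[OF conjunct2[OF F'[unfolded cycle_family_def]]] \<beta>J[OF that]]
    unfolding b\<beta>[OF that] by auto
  have dW: "mdist W (\<beta> i, y) (\<beta> i, y') = e (\<beta> i) y y'"
    if "i \<in> I" "y \<in> Y (\<beta> i)" "y' \<in> Y (\<beta> i)" for i y y'
    using W \<beta>J that by (auto simp: coarse_disjoint_union_def)
  have dZ: "mdist Z (i, x) (i, x') = d i x x'" if "i \<in> I" "x \<in> X i" "x' \<in> X i" for i x x'
    using Z that by (auto simp: coarse_disjoint_union_def)

  \<comment> \<open>Passing from \<open>g\<close> to \<open>g'\<close> after \<open>h\<close> moves
    each endpoint by at most \<open>L'\<close>.\<close>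
  have near: "\<bar>cycle_dist (b i) (g i x) (g i y)
      - cycle_dist (b i) (g' (\<beta> i) (h i x)) (g' (\<beta> i) (h i y))\<bar> \<le> 2 * L'"
    if i: "i \<in> I" and x: "x \<in> X i" and y: "y \<in> X i" for i x y
    using h(2)[OF i x] h(2)[OF i y]
      cycle_dist_commute[of "b i" "g i x" "g' (\<beta> i) (h i x)"]
      cycle_dist_commute[of "b i" "g i y" "g' (\<beta> i) (h i y)"]
      cycle_dist_triangle[OF pos[OF i], of "g i x" "g i y" "g' (\<beta> i) (h i x)"]
      cycle_dist_triangle[OF pos[OF i], of "g' (\<beta> i) (h i x)" "g i y" "g' (\<beta> i) (h i y)"]
      cycle_dist_triangle[OF pos[OF i], of "g' (\<beta> i) (h i x)" "g' (\<beta> i) (h i y)" "g i x"]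
      cycle_dist_triangle[OF pos[OF i], of "g i x" "g' (\<beta> i) (h i y)" "g i y"]
    by linarith

  have up: "\<exists>R'. \<forall>p\<in>mspace Z. \<forall>q\<in>mspace Z. mdist Z p q \<le> R \<longrightarrow> mdist W (f p) (f q) \<le> R'" for R
  proof (rule coarse_disjoint_union_map[OF Z W f cycle_family_finite_diam_le[OF F] FI(1),
        where K = "L' * L + 2 * L' * L' + L'"])
    fix i x y assume i: "i \<in> I" and x: "x \<in> X i" and y: "y \<in> X i"
    have "e (\<beta> i) (h i x) (h i y) \<le> L' * (L * d i x y + L + 2 * L') + L'"
    proof -
      have "e (\<beta> i) (h i x) (h i y) \<le>
          L' * cycle_dist (b i) (g' (\<beta> i) (h i x)) (g' (\<beta> i) (h i y)) + L'"
        using FJ(2)[OF i] h i x y by blast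
      also have "\<dots> \<le> L' * (L * d i x y + L + 2 * L') + L'"
        using near[OF i x y] FI(3)[OF i x y] L by (intro add_right_mono mult_left_mono) auto
      finally show ?thesis .
    qed
    \<comment> \<open>Nonnegative distances allow the offset \<open>2 * L' * L' + L'\<close> to be
      added to the slope, so that a single \<open>K\<close> serves as both.\<close>
    moreover have "0 \<le> d i x y" using dZ[OF i x y] mdist_nonneg[of Z] by metis
    then have "0 \<le> (2 * L' * L' + L') * d i x y" using L by simp
    ultimately show "mdist W (f (i, x)) (f (i, y)) \<le>
        (L' * L + 2 * L' * L' + L') * d i x y + (L' * L + 2 * L' * L' + L')"
      using dW[OF i h(1)[OF i x] h(1)[OF i y]]
      by (simp add: f_def algebra_simps)
  qed (use L in auto)

  have finW: "finite {j\<in>J. diam (Y j) (e j) \<le> R}" for R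
    using cycle_family_finite_diam_le[OF F'] .

  \<comment> \<open>\<open>f\<close> need not have an inverse to which
    \<open>coarse_disjoint_union_map\<close> could be applied. The finite exceptional set is
    therefore taken in the source, over the components whose partners in \<open>W\<close> have small
    diameter.\<close>
  have lo: "\<exists>R'. \<forall>p\<in>mspace Z. \<forall>q\<in>mspace Z. mdist W (f p) (f q) \<le> R \<longrightarrow> mdist Z p q \<le> R'" for R
  proof -
    define A where "A = Sigma {i\<in>I. diam (Y (\<beta> i)) (e (\<beta> i)) \<le> R} X"
    have "finite {i\<in>I. diam (Y (\<beta> i)) (e (\<beta> i)) \<le> R}"
      by (rule inj_on_finite[of \<beta> _ "{j\<in>J. diam (Y j) (e j) \<le> R}"])
        (use \<beta> \<beta>J finW in \<open>auto simp: bij_betw_def inj_on_def\<close>)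
    then have "finite A" unfolding A_def using FI(1) by (intro finite_SigmaI) auto
    then obtain B where B: "\<And>p q. p \<in> A \<Longrightarrow> q \<in> A \<Longrightarrow> mdist Z p q \<le> B"
      using bdd_above_finite[of "(\<lambda>(p, q). mdist Z p q) ` (A \<times> A)"]
      by (fastforce simp: bdd_above_def)
    define C where "C = L * (L' * R + L' + 2 * L') + L"
    have "mdist Z p q \<le> max B C"
      if p: "p \<in> mspace Z" and q: "q \<in> mspace Z" and le: "mdist W (f p) (f q) \<le> R" for p q
    proof -
      obtain i x j y where pq: "p = (i, x)" "q = (j, y)" "i \<in> I" "j \<in> I" "x \<in> X i" "y \<in> X j"
        using p q sp by auto
      show ?thesis
      proof (cases "i = j")
        case True
        then have i: "i \<in> I" and x: "x \<in> X i" and y: "y \<in> X i" using pq by auto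
        have "e (\<beta> i) (h i x) (h i y) \<le> R"
          using le True pq dW[OF i h(1)[OF i x] h(1)[OF i y]] by (simp add: f_def)
        then have "L' * e (\<beta> i) (h i x) (h i y) \<le> L' * R" using L by (intro mult_left_mono)
        then have "cycle_dist (b i) (g i x) (g i y) \<le> L' * R + L' + 2 * L'"
          using near[OF i x y] FJ(3)[OF i h(1)[OF i x] h(1)[OF i y]] by linarith
        then have "L * cycle_dist (b i) (g i x) (g i y) \<le> L * (L' * R + L' + 2 * L')"
          using L by (intro mult_left_mono)
        then have "mdist Z p q \<le> C"
          using FI(2)[OF i x y] dZ[OF i x y] pq True by (simp add: C_def)
        then show ?thesis by simp
      next
        case False
        then have "\<beta> i \<noteq> \<beta> j" using \<beta> pq by (auto simp: bij_betw_def inj_on_def)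
        then have "max (diam (Y (\<beta> i)) (e (\<beta> i))) (diam (Y (\<beta> j)) (e (\<beta> j))) \<le> mdist W (f p) (f q)"
          using W pq \<beta>J h(1) by (auto simp: coarse_disjoint_union_def f_def)
        then have "p \<in> A" "q \<in> A" using le pq by (auto simp: A_def)
        then show ?thesis using B by fastforce
      qed
    qed
    then show ?thesis by blast
  qed

  have "\<exists>p\<in>mspace Z. mdist W q (f p) \<le> L' * (L + L') + L'" if qW: "q \<in> mspace W" for q
  proof -
    obtain j y where q: "q = (j, y)" "j \<in> J" "y \<in> Y j" using qW sp by auto
    then obtain i where i: "i \<in> I" "j = \<beta> i" using \<beta> by (auto simp: bij_betw_def)
    have y: "y \<in> Y (\<beta> i)" using q i by simp
    obtain x where x: "x \<in> X i" "cycle_dist (b i) (g' (\<beta> i) y) (g i x) \<le> L"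
      using FI(4)[OF i(1) FJ(4)[OF i(1) y]] by blast
    have "cycle_dist (b i) (g' (\<beta> i) y) (g' (\<beta> i) (h i x)) \<le> L + L'"
      using cycle_dist_triangle[OF pos[OF i(1)], of "g' (\<beta> i) y" "g' (\<beta> i) (h i x)" "g i x"]
        x h(2)[OF i(1) x(1)] by linarith
    then have "L' * cycle_dist (b i) (g' (\<beta> i) y) (g' (\<beta> i) (h i x)) \<le> L' * (L + L')"
      using L by (intro mult_left_mono)
    then have "e (\<beta> i) y (h i x) \<le> L' * (L + L') + L'"
      using FJ(2)[OF i(1) y h(1)[OF i(1) x(1)]] by linarith
    then have "mdist W q (f (i, x)) \<le> L' * (L + L') + L'"
      using dW[OF i(1) y h(1)[OF i(1) x(1)]] q i by (simp add: f_def)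
    then show ?thesis using i x sp by blast
  qed
  moreover have "0 \<le> L' * (L + L') + L'" using L by simp
  ultimately have "\<exists>R\<ge>0. \<forall>q\<in>mspace W. \<exists>p\<in>mspace Z. mdist W q (f p) \<le> R" by blast
  then show ?thesis
    using coarse_embeddingI[OF f up lo]
    unfolding coarsely_equivalent_def coarse_equivalence_def by blast
qed

lemma cycle_family_cycles:
  "cycle_family {1..} (\<lambda>n. {..<n}) (\<lambda>n. graph_dist (cycle_edges n)) id (\<lambda>n x. x) 1"
proof -
  have "\<exists>x\<in>{..<n}. cycle_dist n p x \<le> 1" if "p < n" for n p
    using that by (intro bexI[of _ p]) (auto simp: cycle_dist_self)
  moreover have "graph_dist (cycle_edges n) x y \<le> 1 * cycle_dist n x y + 1 \<and>
      cycle_dist n x y \<le> 1 * graph_dist (cycle_edges n) x y + 1"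
    if "x \<in> {..<n}" "y \<in> {..<n}" for x y n
    using that by (simp add: graph_dist_cycle_edges)
  moreover have "{..<n} \<noteq> {}" if "n \<in> {1..}" for n :: nat
    using that by (auto simp: lessThan_empty_iff)
  ultimately show ?thesis
    unfolding cycle_family_def id_apply by (intro conjI ballI allI impI) (auto simp: bij_betw_def)
qed

section \<open>Enumerating a family by size\<close>

text \<open>The elements are sorted by \<open>k\<close> and numbered. At most \<open>M\<close> of
  them share a value, so not too many precede a given one; the \<open>v j\<close> occupy all
  positive multiples of \<open>m\<close>, so not too few do.\<close>

lemma ex_rank_bijection:
  fixes k :: "'i \<Rightarrow> nat"
  assumes lev: "\<And>n. finite {i\<in>I. k i = n}" "\<And>n. card {i\<in>I. k i = n} \<le> M"
    and m: "m > 0" and v: "\<And>j. j \<ge> 1 \<Longrightarrow> v j \<in> I" "\<And>j. j \<ge> 1 \<Longrightarrow> k (v j) = m * j"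
  shows "\<exists>b. bij_betw b I {1..} \<and> (\<forall>i\<in>I. b i \<le> M * k i + M \<and> k i \<le> m * b i)"
proof -
  have "\<exists>f. inj_on f {i\<in>I. k i = n} \<and> f ` {i\<in>I. k i = n} \<subseteq> {..<M}" for n
    using card_le_inj[of "{i\<in>I. k i = n}" "{..<M}"] lev[of n] by auto
  then obtain f where f: "\<And>n. inj_on (f n) {i\<in>I. k i = n}" "\<And>n. f n ` {i\<in>I. k i = n} \<subseteq> {..<M}"
    by metis
  have fM: "f (k i) i < M" if "i \<in> I" for i using f(2)[of "k i"] that by auto
  \<comment> \<open>A numerical code for the lexicographic order by \<open>k i\<close> and then by
    the position in the level; positions stay below \<open>M\<close>, so levels do not
    overlap.\<close>
  define c where "c i = M * k i + f (k i) i" for i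
  have c_less: "c i < c i'" if "i \<in> I" "i' \<in> I" "k i < k i'" for i i'
  proof -
    have "c i < M * Suc (k i)" using fM[OF that(1)] by (simp add: c_def)
    also have "\<dots> \<le> M * k i'" using that(3) by (intro mult_le_mono) auto
    finally show ?thesis by (simp add: c_def)
  qed
  have inj: "inj_on c I"
  proof (rule inj_onI)
    fix i i' assume i: "i \<in> I" "i' \<in> I" "c i = c i'"
    then have eq: "k i = k i'" using c_less by (metis less_irrefl nat_neq_iff)
    then have "f (k i) i = f (k i) i'" using i(3) by (simp add: c_def)
    then show "i = i'" using f(1)[of "k i"] i eq by (auto simp: inj_on_def)
  qed
  have v_inj: "inj_on v {1..}"
  proof (rule inj_onI)
    fix j j' :: nat assume j: "j \<in> {1..}" "j' \<in> {1..}" "v j = v j'"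
    have "m * j = k (v j)" "m * j' = k (v j')" using v(2)[of j] v(2)[of j'] j(1,2) by simp_all
    then have "m * j = m * j'" using j(3) by simp
    then show "j = j'" using m by simp
  qed
  have "infinite I"
    using infinite_super[of "v ` {1..}" I] v(1) v_inj finite_image_iff infinite_Ici by blast
  then have inf: "infinite (c ` I)" using inj finite_image_iff by blast
  define E where "E = enumerate (c ` I)"
  have E: "bij_betw E UNIV (c ` I)" unfolding E_def by (rule bij_enumerate[OF inf])
  define r where "r i = inv_into UNIV E (c i)" for i
  have r: "E (r i) = c i" if "i \<in> I" for i
    unfolding r_def by (rule f_inv_into_f) (use E that in \<open>auto simp: bij_betw_def\<close>)
  have rb: "bij_betw r I UNIV"
    using bij_betw_trans[OF inj_on_imp_bij_betw[OF inj] bij_betw_inv_into[OF E]]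
    unfolding r_def comp_def .
  \<comment> \<open>\<open>enumerate\<close> counts from 0, the cycles from 1.\<close>
  have "bij_betw Suc UNIV {1..}"
    by (rule bij_betw_byWitness[of _ "\<lambda>n. n - 1"]) auto
  from bij_betw_trans[OF rb this] have "bij_betw (\<lambda>i. Suc (r i)) I {1..}" unfolding comp_def .
  moreover have "Suc (r i) \<le> M * k i + M" if "i \<in> I" for i
  proof -
    have "r i \<le> c i" using le_enumerate[OF inf, of "r i"] r[OF that] by (simp add: E_def)
    also have "\<dots> < M * k i + M" using fM[OF that] by (simp add: c_def)
    finally show ?thesis by simp
  qed
  moreover have "k i \<le> m * Suc (r i)" if i: "i \<in> I" for i
  proof -
    \<comment> \<open>For \<open>j \<ge> 1\<close>, \<open>j \<le> t\<close> says exactly that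
      \<open>m * j < k i\<close>, so \<open>v 1\<close> to \<open>v t\<close> all precede
      \<open>i\<close>.\<close>
    define t where "t = (k i - 1) div m"
    have "(r \<circ> v) ` {1..t} \<subseteq> {..<r i}"
    proof clarsimp
      fix j assume j: "Suc 0 \<le> j" "j \<le> t"
      have "m * j \<le> m * t" using j by simp
      also have "\<dots> \<le> k i - 1" by (simp add: t_def)
      finally have "m * j \<le> k i - 1" .
      moreover have "m * j > 0" using m j by simp
      ultimately have "k (v j) < k i" using v(2)[of j] j by linarith
      then have "c (v j) < c i" using c_less v(1) i j by simp
      then have "E (r (v j)) < E (r i)" using r i v(1) j by simp
      then show "r (v j) < r i" using inf by (simp add: E_def)
    qed
    moreover have "inj_on (r \<circ> v) {1..t}"
    proof (rule comp_inj_on)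
      show "inj_on v {1..t}" using v_inj by (rule inj_on_subset) auto
      show "inj_on r (v ` {1..t})"
        using bij_betw_imp_inj_on[OF rb] by (rule inj_on_subset) (use v(1) in auto)
    qed
    ultimately have "t \<le> r i"
      using card_inj_on_le[of "r \<circ> v" "{1..t}" "{..<r i}"] by simp
    have "k i - 1 < m * Suc t"
      using m dividend_less_times_div[of m "k i - 1"] by (simp add: t_def)
    also have "\<dots> \<le> m * Suc (r i)" using \<open>t \<le> r i\<close> by (intro mult_le_mono) auto
    finally show ?thesis by simp
  qed
  ultimately show ?thesis by blast
qed

section \<open>Word length\<close>

lemma word_length_le:
  assumes "set ws \<subseteq> S \<union> (\<lambda>s. inv\<^bsub>G\<^esub> s) ` S" "foldr (\<lambda>a b. a \<otimes>\<^bsub>G\<^esub> b) ws \<one>\<^bsub>G\<^esub> = g"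
  shows "word_length G S g \<le> length ws"
  unfolding word_length_def using assms by (intro Least_le) blast

context group
begin

lemma foldr_mult_closed: "set ws \<subseteq> carrier G \<Longrightarrow> foldr (\<lambda>a b. a \<otimes> b) ws \<one> \<in> carrier G"
  by (induction ws) auto

lemma foldr_mult_append:
  assumes "set us \<subseteq> carrier G" "set vs \<subseteq> carrier G"
  shows "foldr (\<lambda>a b. a \<otimes> b) (us @ vs) \<one> = foldr (\<lambda>a b. a \<otimes> b) us \<one> \<otimes> foldr (\<lambda>a b. a \<otimes> b) vs \<one>"
  using assms(1)
  by (induction us) (use foldr_mult_closed[OF assms(2)] foldr_mult_closed in \<open>auto simp: m_assoc\<close>)

lemma letters_closed: "S \<subseteq> carrier G \<Longrightarrow> S \<union> (\<lambda>s. inv s) ` S \<subseteq> carrier G"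
  by auto

lemma ex_word:
  assumes S: "S \<subseteq> carrier G" and g: "g \<in> generate G S"
  shows "\<exists>ws. set ws \<subseteq> S \<union> (\<lambda>s. inv s) ` S \<and> foldr (\<lambda>a b. a \<otimes> b) ws \<one> = g"
  using g
proof (induction rule: generate.induct)
  case one
  show ?case by (rule exI[of _ "[]"]) simp
next
  case (incl h)
  then show ?case using S by (intro exI[of _ "[h]"]) auto
next
  case (inv h)
  then show ?case using S by (intro exI[of _ "[inv h]"]) auto
next
  case (eng g h)
  then obtain us vs where "set us \<subseteq> S \<union> (\<lambda>s. inv s) ` S" "foldr (\<lambda>a b. a \<otimes> b) us \<one> = g"
    "set vs \<subseteq> S \<union> (\<lambda>s. inv s) ` S" "foldr (\<lambda>a b. a \<otimes> b) vs \<one> = h" by blast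
  then show ?case
    using letters_closed[OF S] foldr_mult_append[of us vs] by (intro exI[of _ "us @ vs"]) auto
qed

lemma word_length_word:
  assumes "S \<subseteq> carrier G" "g \<in> generate G S"
  obtains ws where "set ws \<subseteq> S \<union> (\<lambda>s. inv s) ` S" "length ws = word_length G S g"
    "foldr (\<lambda>a b. a \<otimes> b) ws \<one> = g"
proof -
  have "\<exists>n ws. set ws \<subseteq> S \<union> (\<lambda>s. inv s) ` S \<and> length ws = n \<and> foldr (\<lambda>a b. a \<otimes> b) ws \<one> = g"
    using ex_word[OF assms] by blast
  from LeastI_ex[OF this] show ?thesis
    using that unfolding word_length_def by blast
qed

lemma word_length_mult:
  assumes S: "S \<subseteq> carrier G" and g: "g \<in> generate G S" and h: "h \<in> generate G S"
  shows "word_length G S (g \<otimes> h) \<le> word_length G S g + word_length G S h"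
proof -
  obtain us vs where us: "set us \<subseteq> S \<union> (\<lambda>s. inv s) ` S" "length us = word_length G S g"
      "foldr (\<lambda>a b. a \<otimes> b) us \<one> = g"
    and vs: "set vs \<subseteq> S \<union> (\<lambda>s. inv s) ` S" "length vs = word_length G S h"
      "foldr (\<lambda>a b. a \<otimes> b) vs \<one> = h"
    using word_length_word[OF S g] word_length_word[OF S h] by metis
  have "foldr (\<lambda>a b. a \<otimes> b) (us @ vs) \<one> = g \<otimes> h"
    using foldr_mult_append[of us vs] us vs letters_closed[OF S] by auto
  then have "word_length G S (g \<otimes> h) \<le> length (us @ vs)"
    using us vs by (intro word_length_le) auto
  then show ?thesis using us vs by simp
qed

lemma word_length_one: "word_length G S \<one> = 0"
  using word_length_le[of "[]" S G \<one>] by simp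

lemma word_length_pow:
  assumes S: "S \<subseteq> carrier G" and gen: "generate G S = carrier G" and g: "g \<in> carrier G"
  shows "word_length G S (g [^] (n::nat)) \<le> n * word_length G S g"
proof (induction n)
  case (Suc n)
  then show ?case using word_length_mult[OF S, of "g [^] n" g] g gen by simp
qed (simp add: word_length_one)

lemma word_length_int_pow:
  assumes S: "S \<subseteq> carrier G" and gen: "generate G S = carrier G" and g: "g \<in> carrier G"
  shows "int (word_length G S (g [^] (z::int)))
    \<le> \<bar>z\<bar> * int (max (word_length G S g) (word_length G S (inv g)))"
proof -
  \<comment> \<open>Negative exponents are powers of \<open>inv g\<close>; the maximum covers both
    signs without comparing the lengths of \<open>g\<close> and \<open>inv g\<close>.\<close>
  define M where "M = max (word_length G S g) (word_length G S (inv g))"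
  have *: "word_length G S (x [^] n) \<le> n * M" if "x = g \<or> x = inv g" for x and n :: nat
  proof -
    have "x \<in> carrier G" using that g by auto
    then have "word_length G S (x [^] n) \<le> n * word_length G S x"
      by (rule word_length_pow[OF S gen])
    also have "\<dots> \<le> n * M" using that by (intro mult_le_mono) (auto simp: M_def)
    finally show ?thesis .
  qed
  obtain x where x: "x = g \<or> x = inv g" "g [^] z = x [^] nat \<bar>z\<bar>"
  proof (cases "z < 0")
    case True
    have "g [^] z = inv (g [^] nat (- z))" unfolding int_pow_def2 using True by (rule if_P)
    also have "\<dots> = inv g [^] nat (- z)" by (rule nat_pow_inv[OF g, symmetric])
    also have "nat (- z) = nat \<bar>z\<bar>" using True by linarith
    finally show ?thesis using that by blast
  next
    case False
    have "g [^] z = g [^] nat z" unfolding int_pow_def2 using False by (rule if_not_P)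
    also have "nat z = nat \<bar>z\<bar>" using False by linarith
    finally show ?thesis using that by blast
  qed
  have "word_length G S (g [^] z) \<le> nat \<bar>z\<bar> * M" unfolding x(2) by (rule *[OF x(1)])
  then have "int (word_length G S (g [^] z)) \<le> int (nat \<bar>z\<bar> * M)" by (rule of_nat_mono)
  then show ?thesis unfolding of_nat_mult M_def by simp
qed

end

section \<open>Word length in the quotient by a normal subgroup\<close>

context normal
begin

lemma foldr_cosets:
  "set ws \<subseteq> carrier G \<Longrightarrow>
    foldr (\<lambda>a b. a \<otimes>\<^bsub>G Mod H\<^esub> b) (map (\<lambda>s. H #> s) ws) \<one>\<^bsub>G Mod H\<^esub>
      = H #> foldr (\<lambda>a b. a \<otimes> b) ws \<one>"
  by (induction ws) (use subset foldr_mult_closed in \<open>auto simp: rcos_sum coset_mult_one\<close>)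

lemma inv_coset: "x \<in> carrier G \<Longrightarrow> inv\<^bsub>G Mod H\<^esub> (H #> x) = H #> inv x"
  using inv_FactGroup[of "H #> x"] by (simp add: carrier_FactGroup rcos_inv)

lemma coset_letters:
  "S \<subseteq> carrier G \<Longrightarrow> (\<lambda>s. H #> s) ` S \<union> (\<lambda>s. inv\<^bsub>G Mod H\<^esub> s) ` (\<lambda>s. H #> s) ` S
    = (\<lambda>s. H #> s) ` (S \<union> (\<lambda>s. inv s) ` S)"
  unfolding image_Un image_image by (rule arg_cong2[where f = "(\<union>)"]) (auto simp: inv_coset subset_iff)

lemma word_length_coset_le:
  assumes S: "S \<subseteq> carrier G" and gen: "generate G S = carrier G" and g: "g \<in> carrier G"
  shows "word_length (G Mod H) ((\<lambda>s. H #> s) ` S) (H #> g) \<le> word_length G S g"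
proof -
  obtain ws where ws: "set ws \<subseteq> S \<union> (\<lambda>s. inv s) ` S" "length ws = word_length G S g"
      "foldr (\<lambda>a b. a \<otimes> b) ws \<one> = g"
    using word_length_word[OF S] g gen by metis
  have "word_length (G Mod H) ((\<lambda>s. H #> s) ` S) (H #> g) \<le> length (map (\<lambda>s. H #> s) ws)"
  proof (rule word_length_le)
    show "set (map (\<lambda>s. H #> s) ws)
        \<subseteq> (\<lambda>s. H #> s) ` S \<union> (\<lambda>s. inv\<^bsub>G Mod H\<^esub> s) ` (\<lambda>s. H #> s) ` S"
      unfolding coset_letters[OF S] using ws(1) by auto
    show "foldr (\<lambda>a b. a \<otimes>\<^bsub>G Mod H\<^esub> b) (map (\<lambda>s. H #> s) ws) \<one>\<^bsub>G Mod H\<^esub> = H #> g"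
      using foldr_cosets[OF subset_trans[OF ws(1) letters_closed[OF S]]] ws(3) by simp
  qed
  then show ?thesis using ws(2) by simp
qed

text \<open>By \<open>coset_letters\<close> a shortest word of the quotient lifts letter by letter.
  Lower bounds for lengths in the quotient thus reduce to lower bounds in \<open>G\<close>.\<close>

lemma word_length_coset_rep:
  assumes S: "S \<subseteq> carrier G" and gen: "generate G S = carrier G" and g: "g \<in> carrier G"
  obtains w where "w \<in> carrier G" "H #> w = H #> g"
    "word_length G S w \<le> word_length (G Mod H) ((\<lambda>s. H #> s) ` S) (H #> g)"
proof -
  let ?l = "word_length (G Mod H) ((\<lambda>s. H #> s) ` S) (H #> g)"
  obtain us where us: "set us \<subseteq> S \<union> (\<lambda>s. inv s) ` S" "foldr (\<lambda>a b. a \<otimes> b) us \<one> = g"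
    using ex_word[OF S] g gen by metis
  let ?P = "\<lambda>n. \<exists>ws. set ws \<subseteq> (\<lambda>s. H #> s) ` S \<union> (\<lambda>s. inv\<^bsub>G Mod H\<^esub> s) ` (\<lambda>s. H #> s) ` S
      \<and> length ws = n \<and> foldr (\<lambda>a b. a \<otimes>\<^bsub>G Mod H\<^esub> b) ws \<one>\<^bsub>G Mod H\<^esub> = H #> g"
  have "set (map (\<lambda>s. H #> s) us) \<subseteq> (\<lambda>s. H #> s) ` (S \<union> (\<lambda>s. inv s) ` S)"
    unfolding set_map by (rule image_mono[OF us(1)])
  moreover have "foldr (\<lambda>a b. a \<otimes>\<^bsub>G Mod H\<^esub> b) (map (\<lambda>s. H #> s) us) \<one>\<^bsub>G Mod H\<^esub> = H #> g"
    using foldr_cosets[OF subset_trans[OF us(1) letters_closed[OF S]]] us(2) by simp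
  ultimately have "?P (length (map (\<lambda>s. H #> s) us))"
    unfolding coset_letters[OF S] by blast
  then have "?P (LEAST n. ?P n)" by (rule LeastI)
  then obtain ws
    where ws: "set ws \<subseteq> (\<lambda>s. H #> s) ` (S \<union> (\<lambda>s. inv s) ` S)" "length ws = ?l"
      "foldr (\<lambda>a b. a \<otimes>\<^bsub>G Mod H\<^esub> b) ws \<one>\<^bsub>G Mod H\<^esub> = H #> g"
    unfolding word_length_def coset_letters[OF S] by (elim exE conjE)
  have "ws \<in> lists ((\<lambda>s. H #> s) ` (S \<union> (\<lambda>s. inv s) ` S))"
    unfolding lists_eq_set using ws(1) by (rule CollectI)
  then have "ws \<in> map (\<lambda>s. H #> s) ` lists (S \<union> (\<lambda>s. inv s) ` S)"
    unfolding lists_image .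
  then obtain vs where vs: "set vs \<subseteq> S \<union> (\<lambda>s. inv s) ` S" "ws = map (\<lambda>s. H #> s) vs"
    unfolding lists_eq_set by blast
  define w where "w = foldr (\<lambda>a b. a \<otimes> b) vs \<one>"
  have "w \<in> carrier G"
    unfolding w_def
    by (rule foldr_mult_closed[OF subset_trans[OF vs(1) letters_closed[OF S]]])
  moreover have "H #> w = H #> g"
    using ws(3) vs(2) foldr_cosets[OF subset_trans[OF vs(1) letters_closed[OF S]]]
    unfolding w_def by simp
  moreover have "word_length G S w \<le> ?l"
    using word_length_le[of vs S G w] vs ws(2) by (simp add: w_def)
  ultimately show ?thesis by (rule that)
qed

end

section \<open>Groups acting on the line\<close>

lemma (in group) conj_int_pow:
  assumes "g \<in> carrier G" "x \<in> carrier G"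
  shows "g \<otimes> x [^] (z::int) \<otimes> inv g = (g \<otimes> x \<otimes> inv g) [^] z"
proof -
  have "(\<lambda>x. g \<otimes> x \<otimes> inv g) \<in> hom G G"
    using assms(1) by (auto simp: hom_def m_assoc inv_solve_left)
  from hom_int_pow[OF this assms(2) is_group] show ?thesis
    using is_group by simp
qed

lemma (in group) coset_absorb:
  assumes "subgroup N G" "n \<in> N" "x \<in> carrier G"
  shows "N #> (n \<otimes> x) = N #> x"
proof -
  have n: "n \<in> carrier G" using assms subgroup.mem_carrier by metis
  have "N #> (n \<otimes> x) = N #> n #> x"
    by (rule coset_mult_assoc[OF subgroup.subset[OF assms(1)] n assms(3), symmetric])
  then show ?thesis unfolding coset_join2[OF n assms(1,2)] .
qed

text \<open>The element \<open>x\<close> acts on the integers by \<open>z \<mapsto> psi x + e x * z\<close>, so \<open>psi\<close> is the orbit map of \<open>0\<close>;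
  stabilizers are finite, and \<open>a\<close> is a translation generating a normal subgroup.\<close>

locale line_action = group G for G (structure) +
  fixes e psi :: "'a \<Rightarrow> int" and a :: 'a and m :: nat
  assumes a_closed [simp, intro]: "a \<in> carrier G"
    and m_pos: "m > 0"
    and e_a: "e a = 1" and psi_a: "psi a = int m"
    and e_sign: "x \<in> carrier G \<Longrightarrow> e x = 1 \<or> e x = - 1"
    and e_mult: "\<lbrakk>x \<in> carrier G; y \<in> carrier G\<rbrakk> \<Longrightarrow> e (x \<otimes> y) = e x * e y"
    and psi_mult: "\<lbrakk>x \<in> carrier G; y \<in> carrier G\<rbrakk> \<Longrightarrow> psi (x \<otimes> y) = psi x + e x * psi y"
    and conj_a: "x \<in> carrier G \<Longrightarrow> x \<otimes> a \<otimes> inv x = a [^] e x"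
    and finite_stabilizer: "finite {x \<in> carrier G. psi x = 0}"
begin

lemma e_square: "x \<in> carrier G \<Longrightarrow> e x * e x = 1"
  using e_sign by fastforce

lemma e_one: "e \<one> = 1"
  using e_mult[of \<one> \<one>] e_sign[of \<one>] by auto

lemma psi_one: "psi \<one> = 0"
  using psi_mult[of \<one> \<one>] e_one by simp

lemma e_inv: "x \<in> carrier G \<Longrightarrow> e (inv x) = e x"
  using e_mult[of x "inv x"] e_one e_sign[of x] by auto

lemma psi_inv: "x \<in> carrier G \<Longrightarrow> psi (inv x) = - e x * psi x"
  using psi_mult[of "inv x" x] psi_one e_inv by simp

text \<open>Since \<open>inv x\<close> acts as an isometry, this is the difference of two orbit
  points up to sign. It is the form in which \<open>psi\<close> meets the left invariant word
  metric.\<close>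

lemma psi_inv_mult:
  assumes "x \<in> carrier G" "y \<in> carrier G"
  shows "psi (inv x \<otimes> y) = e x * (psi y - psi x)"
  using assms by (simp add: psi_mult psi_inv e_inv algebra_simps)

lemma e_pow:
  assumes u: "u \<in> carrier G" "e u = 1"
  shows "e (u [^] (n::nat)) = 1" "psi (u [^] n) = int n * psi u"
proof (induction n)
  case 0
  { case 1 show ?case using e_one by simp }
  { case 2 show ?case using psi_one by simp }
next
  case (Suc n)
  { case 1 show ?case using Suc u by (simp add: e_mult) }
  { case 2 show ?case using Suc u by (simp add: psi_mult algebra_simps) }
qed

lemma e_int_pow:
  assumes u: "u \<in> carrier G" "e u = 1"
  shows "e (u [^] (z::int)) = 1" "psi (u [^] z) = z * psi u"
proof -
  have "e (u [^] z) = 1 \<and> psi (u [^] z) = z * psi u"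
  proof (cases z rule: int_cases2)
    case (nonneg n)
    then show ?thesis
      unfolding nonneg int_pow_int using e_pow[OF u, of n] by blast
  next
    case (nonpos n)
    have "e (inv (u [^] n)) = 1" "psi (inv (u [^] n)) = - (int n * psi u)"
      using e_inv[of "u [^] n"] psi_inv[of "u [^] n"] e_pow[OF u, of n] u(1) by auto
    then show ?thesis
      unfolding nonpos int_pow_neg_int[OF u(1)] by simp
  qed
  then show "e (u [^] z) = 1" "psi (u [^] z) = z * psi u" by auto
qed

lemma e_a_pow: "e (a [^] (z::int)) = 1" and psi_a_pow: "psi (a [^] (z::int)) = z * int m"
  using e_int_pow[OF a_closed e_a] psi_a by auto

text \<open>Left multiplication by \<open>inv y\<close>, for any \<open>y\<close> in the fibre,
  embeds the fibre into the stabilizer of 0.\<close>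

lemma fibre:
  "finite {x \<in> carrier G. psi x = z} \<and>
   card {x \<in> carrier G. psi x = z} \<le> card {x \<in> carrier G. psi x = 0}"
proof (cases "{x \<in> carrier G. psi x = z} = {}")
  case True
  show ?thesis unfolding True by simp
next
  case False
  then obtain y where y: "y \<in> carrier G" "psi y = z" by blast
  have inj: "inj_on (\<lambda>x. inv y \<otimes> x) {x \<in> carrier G. psi x = z}"
    using y by (auto simp: inj_on_def)
  have sub: "(\<lambda>x. inv y \<otimes> x) ` {x \<in> carrier G. psi x = z} \<subseteq> {x \<in> carrier G. psi x = 0}"
    using y by (auto simp: psi_inv_mult)
  show ?thesis
    using inj_on_finite[OF inj sub finite_stabilizer] card_inj_on_le[OF inj sub finite_stabilizer]
    by (rule conjI)
qed

lemma fibres: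
  assumes "finite A"
  shows "finite {x \<in> carrier G. psi x \<in> A}"
    "card {x \<in> carrier G. psi x \<in> A} \<le> card A * card {x \<in> carrier G. psi x = 0}"
proof -
  have *: "{x \<in> carrier G. psi x \<in> A} = (\<Union>z\<in>A. {x \<in> carrier G. psi x = z})" by auto
  show "finite {x \<in> carrier G. psi x \<in> A}"
    unfolding * using assms fibre by blast
  have "card (\<Union>z\<in>A. {x \<in> carrier G. psi x = z}) \<le> (\<Sum>z\<in>A. card {x \<in> carrier G. psi x = z})"
    by (rule card_UN_le[OF assms])
  also have "\<dots> \<le> (\<Sum>z\<in>A. card {x \<in> carrier G. psi x = 0})"
    using fibre by (intro sum_mono) blast
  finally show "card {x \<in> carrier G. psi x \<in> A} \<le> card A * card {x \<in> carrier G. psi x = 0}"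
    unfolding * by simp
qed

text \<open>One half of the Milnor-Svarc argument: a letter moves 0 by a bounded amount, and under
  isometries these displacements at most add up.\<close>

lemma psi_le_word_length:
  assumes S: "finite_generating_set G S"
  obtains L where "L \<ge> 0" "\<And>g. g \<in> carrier G \<Longrightarrow> \<bar>psi g\<bar> \<le> L * int (word_length G S g)"
proof -
  have S': "finite S" "S \<subseteq> carrier G" "generate G S = carrier G"
    using S by (auto simp: finite_generating_set_def)
  let ?A = "S \<union> (\<lambda>s. inv s) ` S"
  have "finite ?A" using S' by simp
  then obtain L0 where L0: "\<And>s. s \<in> ?A \<Longrightarrow> \<bar>psi s\<bar> \<le> L0"
    using bdd_above_finite[of "(\<lambda>s. \<bar>psi s\<bar>) ` ?A"] by (auto simp: bdd_above_def)
  define L where "L = max L0 0"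
  have word: "\<bar>psi (foldr (\<lambda>a b. a \<otimes> b) ws \<one>)\<bar> \<le> L * int (length ws)" if "set ws \<subseteq> ?A" for ws
    using that
  proof (induction ws)
    case Nil
    then show ?case by (simp add: psi_one)
  next
    case (Cons s ws)
    let ?w = "foldr (\<lambda>a b. a \<otimes> b) ws \<one>"
    have s: "s \<in> carrier G" and w: "?w \<in> carrier G"
      using Cons.prems letters_closed[OF S'(2)] by (auto intro!: foldr_mult_closed)
    have "\<bar>psi (s \<otimes> ?w)\<bar> \<le> \<bar>psi s\<bar> + \<bar>psi ?w\<bar>"
      using psi_mult[OF s w] e_sign[OF s] by auto
    also have "\<dots> \<le> L + L * int (length ws)"
      using Cons L0[of s] by (intro add_mono) (auto simp: L_def)
    finally show ?case by (simp add: algebra_simps)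
  qed
  show ?thesis
  proof (rule that)
    show "L \<ge> 0" by (simp add: L_def)
    fix g assume "g \<in> carrier G"
    then obtain ws where "set ws \<subseteq> ?A" "length ws = word_length G S g"
      "foldr (\<lambda>a b. a \<otimes> b) ws \<one> = g"
      using word_length_word[OF S'(2)] S'(3) by metis
    then show "\<bar>psi g\<bar> \<le> L * int (word_length G S g)" using word by metis
  qed
qed

text \<open>The other half: a power of the translation \<open>a\<close> brings \<open>psi g\<close>
  into \<open>[0, m)\<close>, over which only finitely many elements lie, and the exponent is at
  most \<open>\<bar>psi g\<bar>\<close> in absolute value.\<close>

lemma word_length_le_psi:
  assumes S: "finite_generating_set G S"
  obtains L where "L \<ge> 0" "\<And>g. g \<in> carrier G \<Longrightarrow> int (word_length G S g) \<le> L * \<bar>psi g\<bar> + L"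
proof -
  have S': "finite S" "S \<subseteq> carrier G" "generate G S = carrier G"
    using S by (auto simp: finite_generating_set_def)
  define C where "C = int (max (word_length G S a) (word_length G S (inv a)))"
  have "finite {x \<in> carrier G. psi x \<in> {0..<int m}}" by (rule fibres) simp
  then obtain B where B: "\<And>x. x \<in> carrier G \<Longrightarrow> psi x \<in> {0..<int m} \<Longrightarrow> int (word_length G S x) \<le> B"
    using bdd_above_finite[of "(\<lambda>x. int (word_length G S x)) ` {x \<in> carrier G. psi x \<in> {0..<int m}}"]
    by (auto simp: bdd_above_def)
  define L where "L = max B C"
  have C0: "C \<ge> 0" by (simp add: C_def)
  show ?thesis
  proof (rule that)
    show "L \<ge> 0" using C0 by (simp add: L_def)
    fix g assume g: "g \<in> carrier G"
    define z where "z = psi g div int m"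
    define x where "x = a [^] (- z) \<otimes> g"
    have x: "x \<in> carrier G" using g by (simp add: x_def)
    have "psi x = psi g - z * int m"
      unfolding x_def using g by (simp add: psi_mult e_a_pow psi_a_pow)
    then have "psi x = psi g mod int m"
      by (simp add: z_def minus_div_mult_eq_mod)
    then have "int (word_length G S x) \<le> B" using B[OF x] m_pos by simp
    moreover have "g = a [^] z \<otimes> x"
      unfolding x_def using g by (simp add: int_pow_neg m_assoc[symmetric])
    then have "word_length G S g \<le> word_length G S (a [^] z) + word_length G S x"
      using word_length_mult[OF S'(2), of "a [^] z" x] S'(3) x by simp
    moreover have "int (word_length G S (a [^] z)) \<le> \<bar>z\<bar> * C"
      unfolding C_def by (rule word_length_int_pow[OF S'(2,3) a_closed])
    moreover have "\<bar>z\<bar> * C \<le> \<bar>psi g\<bar> * L"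
    proof (rule mult_mono)
      have "\<bar>psi g div int m\<bar> \<le> \<bar>psi g\<bar>"
        using m_pos zdiv_mono2[of "psi g" 1 "int m"] zdiv_mono2_neg[of "psi g" 1 "int m"]
          pos_imp_zdiv_nonneg_iff[of "int m" "psi g"] pos_imp_zdiv_neg_iff[of "int m" "psi g"]
        by (cases "psi g \<ge> 0") auto
      then show "\<bar>z\<bar> \<le> \<bar>psi g\<bar>" by (simp add: z_def)
    qed (use C0 in \<open>auto simp: L_def\<close>)
    moreover have "B \<le> L" by (simp add: L_def)
    ultimately show "int (word_length G S g) \<le> L * \<bar>psi g\<bar> + L"
      by (simp add: mult.commute)
  qed
qed

text \<open>Powers of the translation \<open>u\<close> bring every coset representative over the
  window \<open>[0, psi u)\<close>, and only finitely many group elements lie there.\<close>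

lemma finite_indexI:
  assumes N: "subgroup N G" and u: "u \<in> N" "e u = 1" "psi u > 0"
  shows "finite (rcosets N)"
proof -
  interpret N: subgroup N G by fact
  have uG: "u \<in> carrier G" using u by simp
  have "rcosets N \<subseteq> (\<lambda>x. N #> x) ` {x \<in> carrier G. psi x \<in> {0..<psi u}}"
  proof
    fix X assume "X \<in> rcosets N"
    then obtain x where x: "x \<in> carrier G" "X = N #> x" by (auto simp: RCOSETS_def)
    define y where "y = u [^] (- (psi x div psi u)) \<otimes> x"
    have "u [^] (- (psi x div psi u)) \<in> N"
      using subgroup_int_pow_closed[OF N u(1)] .
    then have "N #> y = X"
      unfolding y_def x(2) by (rule coset_absorb[OF N _ x(1)])
    moreover have "psi y = psi x mod psi u"
      unfolding y_def using x uG e_int_pow[OF uG u(2)]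
      by (simp add: psi_mult minus_div_mult_eq_mod flip: minus_mult_left)
    ultimately show "X \<in> (\<lambda>x. N #> x) ` {x \<in> carrier G. psi x \<in> {0..<psi u}}"
      using x uG u(3) by (intro image_eqI[of _ _ y]) (auto simp: y_def)
  qed
  then show ?thesis
    using fibres(1)[of "{0..<psi u}"] by (meson finite_surj finite_atLeastLessThan_int)
qed

text \<open>Restricted to \<open>e x = 1\<close> because an element with \<open>e x = - 1\<close>
  squares to one with \<open>psi\<close> equal to 0 and so does not move points arbitrarily far. For
  finite index the \<open>LEAST\<close> is attained by \<open>transl_exists\<close>.\<close>

definition transl :: "'a set \<Rightarrow> nat" where
  "transl N = (LEAST k. k > 0 \<and> (\<exists>x\<in>N. e x = 1 \<and> psi x = int k))"

end

section \<open>Normal subgroups of finite index and the metric of their quotients\<close>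

locale line_action_subgroup = line_action + normal N G for N +
  assumes fin_index: "finite (rcosets N)"
begin

text \<open>Two different powers of \<open>a\<close> lie in the same coset of \<open>N\<close>, and
  their quotient is a translation in \<open>N\<close>.\<close>

lemma transl_exists: "\<exists>k>0. \<exists>x\<in>N. e x = 1 \<and> psi x = int k"
proof -
  have "(\<lambda>i::nat. N #> a [^] i) ` UNIV \<subseteq> rcosets N"
    by (intro image_subsetI rcosetsI[OF subset] nat_pow_closed a_closed)
  then have "\<not> inj (\<lambda>i::nat. N #> a [^] i)"
    using fin_index finite_subset finite_imageD infinite_UNIV_nat by blast
  then obtain i j :: nat where "i \<noteq> j" "N #> a [^] i = N #> a [^] j"
    by (auto simp: inj_on_def)
  then obtain i j :: nat where ij: "i < j" "N #> a [^] i = N #> a [^] j"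
    by (metis linorder_neqE_nat)
  define x where "x = a [^] j \<otimes> inv (a [^] i)"
  have "a [^] j \<in> N #> a [^] i"
    unfolding ij(2) by (rule rcos_self[OF nat_pow_closed[OF a_closed] is_subgroup])
  then have "x \<in> N"
    unfolding x_def using rcos_module[OF is_group] by simp
  moreover have "e x = 1" "psi x = int (m * (j - i))"
    using e_pow[OF a_closed e_a] psi_a ij(1) unfolding x_def
    by (simp_all add: e_mult psi_mult e_inv psi_inv of_nat_diff algebra_simps)
  moreover have "m * (j - i) > 0" using ij m_pos by simp
  ultimately show ?thesis by blast
qed

lemma transl_pos: "transl N > 0"
  and transl_elem: "\<exists>x\<in>N. e x = 1 \<and> psi x = int (transl N)"
  using LeastI_ex[OF transl_exists] unfolding transl_def by auto

text \<open>Division with remainder: a nonzero remainder would be a smaller positive translation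
  length in \<open>N\<close>.\<close>

lemma transl_dvd:
  assumes x: "x \<in> N" "e x = 1"
  shows "int (transl N) dvd psi x"
proof (rule ccontr)
  assume "\<not> int (transl N) dvd psi x"
  obtain u where u: "u \<in> N" "e u = 1" "psi u = int (transl N)" using transl_elem by blast
  have uG: "u \<in> carrier G" and xG: "x \<in> carrier G" using u x by auto
  define y where "y = x \<otimes> u [^] (- (psi x div psi u))"
  have "y \<in> N" unfolding y_def using x subgroup_int_pow_closed[OF is_subgroup u(1)] by blast
  moreover have "e y = 1" "psi y = psi x mod psi u"
    unfolding y_def using xG uG x(2) e_int_pow[OF uG u(2)]
    by (simp_all add: e_mult psi_mult minus_div_mult_eq_mod flip: minus_mult_left)
  moreover have pos: "psi x mod psi u > 0"
  proof -
    have "psi x mod psi u \<noteq> 0"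
      using \<open>\<not> int (transl N) dvd psi x\<close> unfolding u(3) dvd_eq_mod_eq_0 .
    moreover have "0 \<le> psi x mod psi u" unfolding u(3) using transl_pos by simp
    ultimately show ?thesis by linarith
  qed
  ultimately have "transl N \<le> nat (psi x mod psi u)"
    unfolding transl_def by (intro Least_le) (auto intro!: bexI[of _ y])
  moreover have "psi x mod psi u < int (transl N)"
    using pos_mod_bound[of "psi u" "psi x"] u(3) transl_pos by simp
  ultimately show False using pos by linarith
qed

text \<open>A reflection \<open>x\<close> in \<open>N\<close> forces the translation \<open>[a, x]\<close> by \<open>2 * m\<close> into \<open>N\<close>.\<close>

lemma transl_le_reflection:
  assumes x: "x \<in> N" "e x = - 1"
  shows "transl N \<le> 2 * m"
proof -
  have xG: "x \<in> carrier G" using x by simp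
  have "a \<otimes> x \<otimes> inv a \<otimes> inv x \<in> N"
    using x inv_op_closed2[OF a_closed x(1)] by simp
  moreover have "e (a \<otimes> x \<otimes> inv a \<otimes> inv x) = 1"
    using xG x(2) by (simp add: e_mult e_inv e_a)
  moreover have "psi (a \<otimes> x \<otimes> inv a \<otimes> inv x) = int (2 * m)"
    using xG x(2) by (simp add: e_mult psi_mult e_inv psi_inv e_a psi_a)
  ultimately have "int (transl N) dvd int (2 * m)" using transl_dvd by metis
  then have "transl N dvd 2 * m" unfolding int_dvd_int_iff .
  then show ?thesis using m_pos by (intro dvd_imp_le) auto
qed

text \<open>Two elements of a coset differ by some \<open>n\<close> in \<open>N\<close>. If
  \<open>n\<close> preserves orientation, the difference of \<open>psi\<close> is a multiple of
  \<open>transl N\<close>; if \<open>n\<close> is a reflection, \<open>transl N \<le> 2 * m\<close>,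
  and no two points of the cycle are more than \<open>m\<close> apart.\<close>

lemma circ_same_coset:
  assumes x: "x \<in> carrier G" and y: "y \<in> carrier G" and eq: "N #> x = N #> y"
  shows "circ (int (transl N)) (psi x - psi y) \<le> int m"
proof -
  define n where "n = inv y \<otimes> x"
  have "x \<in> y <# N"
    using eq rcos_self[OF x is_subgroup] coset_eq y by blast
  then have nN: "n \<in> N"
    unfolding n_def l_coset_def using y by (auto simp: m_assoc[symmetric])
  have nG: "n \<in> carrier G" using x y by (simp add: n_def)
  have "x = y \<otimes> n" unfolding n_def using x y by (simp add: m_assoc[symmetric])
  then have d: "psi x - psi y = e y * psi n" using y nG by (simp add: psi_mult)
  show ?thesis
  proof (cases "e n = 1")
    case True
    then have "int (transl N) dvd psi x - psi y"
      using transl_dvd[OF nN] unfolding d by simp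
    then show ?thesis unfolding circ_def by simp
  next
    case False
    then have "transl N \<le> 2 * m" using transl_le_reflection[OF nN] e_sign[OF nG] by blast
    then have "int (transl N) div 2 \<le> int m" by linarith
    then show ?thesis
      using circ_le[of "int (transl N)" "psi x - psi y"] transl_pos by simp
  qed
qed

lemma word_metric_coset:
  assumes "x \<in> carrier G" "y \<in> carrier G"
  shows "word_metric (G Mod N) T (N #> x) (N #> y) = real (word_length (G Mod N) T (N #> (inv x \<otimes> y)))"
  using assms by (simp add: word_metric_def inv_coset rcos_sum)

text \<open>A power of a translation in \<open>N\<close> replaces \<open>x\<close> by a
  representative whose distance to \<open>y\<close> on the line is the distance on the cycle. The
  quotient map does not increase word length.\<close>

lemma word_metric_le_circ:
  assumes S: "finite_generating_set G S"
    and L: "\<And>g. g \<in> carrier G \<Longrightarrow> int (word_length G S g) \<le> L * \<bar>psi g\<bar> + L"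
    and x: "x \<in> carrier G" and y: "y \<in> carrier G"
  shows "word_metric (G Mod N) ((\<lambda>s. N #> s) ` S) (N #> x) (N #> y)
    \<le> real_of_int (L * circ (int (transl N)) (psi x - psi y) + L)"
proof -
  obtain u where u: "u \<in> N" "e u = 1" "psi u = int (transl N)" using transl_elem by blast
  have uG: "u \<in> carrier G" using u by auto
  obtain q where q: "circ (int (transl N)) (psi x - psi y) = \<bar>psi x - psi y + int (transl N) * q\<bar>"
    using circ_eq_abs[of "int (transl N)" "psi x - psi y"] transl_pos by auto
  define x' where "x' = u [^] q \<otimes> x"
  have x': "x' \<in> carrier G" using x uG by (simp add: x'_def)
  have "u [^] q \<in> N" using subgroup_int_pow_closed[OF is_subgroup u(1)] .
  then have eq: "N #> x' = N #> x"
    unfolding x'_def by (rule coset_absorb[OF is_subgroup _ x])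
  have "psi x' = psi x + int (transl N) * q"
    unfolding x'_def using x uG e_int_pow[OF uG u(2)] u(3) by (simp add: psi_mult)
  then have "\<bar>psi (inv x' \<otimes> y)\<bar> = circ (int (transl N)) (psi x - psi y)"
    unfolding q psi_inv_mult[OF x' y] using e_sign[OF x'] by auto
  then have "int (word_length G S (inv x' \<otimes> y)) \<le> L * circ (int (transl N)) (psi x - psi y) + L"
    using L[of "inv x' \<otimes> y"] x' y by simp
  moreover have "word_length (G Mod N) ((\<lambda>s. N #> s) ` S) (N #> (inv x' \<otimes> y))
      \<le> word_length G S (inv x' \<otimes> y)"
    using S x' y by (intro word_length_coset_le) (auto simp: finite_generating_set_def)
  moreover have "word_metric (G Mod N) ((\<lambda>s. N #> s) ` S) (N #> x) (N #> y)
      = real (word_length (G Mod N) ((\<lambda>s. N #> s) ` S) (N #> (inv x' \<otimes> y)))"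
    unfolding eq[symmetric] by (rule word_metric_coset[OF x' y])
  ultimately show ?thesis by linarith
qed

text \<open>A shortest word of the quotient lifts to \<open>w\<close>, and \<open>psi\<close> moves
  by at most \<open>L\<close> per letter between \<open>x\<close> and \<open>x \<otimes> w\<close>.
  The extra \<open>m\<close> is the ambiguity of \<open>psi\<close> on the coset containing
  \<open>x \<otimes> w\<close> and \<open>y\<close>.\<close>

lemma circ_le_word_metric:
  assumes S: "finite_generating_set G S"
    and L: "\<And>g. g \<in> carrier G \<Longrightarrow> \<bar>psi g\<bar> \<le> L * int (word_length G S g)" "L \<ge> 0"
    and x: "x \<in> carrier G" and y: "y \<in> carrier G"
  shows "real_of_int (circ (int (transl N)) (psi x - psi y))
    \<le> real_of_int L * word_metric (G Mod N) ((\<lambda>s. N #> s) ` S) (N #> x) (N #> y) + real m"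
proof -
  let ?l = "word_length (G Mod N) ((\<lambda>s. N #> s) ` S) (N #> (inv x \<otimes> y))"
  have pos: "int (transl N) > 0" using transl_pos by simp
  obtain w where w: "w \<in> carrier G" "N #> w = N #> (inv x \<otimes> y)" "word_length G S w \<le> ?l"
    using word_length_coset_rep[of S "inv x \<otimes> y"] S x y
    by (auto simp: finite_generating_set_def)
  have "N #> (x \<otimes> w) = (N #> x) <#> (N #> w)" by (rule rcos_sum[OF x w(1), symmetric])
  also have "\<dots> = N #> (x \<otimes> (inv x \<otimes> y))" unfolding w(2) using x y by (simp add: rcos_sum)
  also have "x \<otimes> (inv x \<otimes> y) = y" using x y by (simp add: m_assoc[symmetric])
  finally have eq: "N #> (x \<otimes> w) = N #> y" .
  have "\<bar>psi (x \<otimes> w) - psi x\<bar> = \<bar>psi w\<bar>"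
    using psi_mult[OF x w(1)] e_sign[OF x] by auto
  also have "\<dots> \<le> L * int (word_length G S w)" using L(1)[OF w(1)] .
  also have "\<dots> \<le> L * int ?l" using L(2) w(3) by (intro mult_left_mono) auto
  finally have "circ (int (transl N)) (psi (x \<otimes> w) - psi x) \<le> L * int ?l"
    using circ_le_abs[OF pos, of "psi (x \<otimes> w) - psi x"] by linarith
  then have "circ (int (transl N)) (psi x - psi (x \<otimes> w)) \<le> L * int ?l"
    by (simp add: circ_diff_commute)
  moreover have "circ (int (transl N)) (psi (x \<otimes> w) - psi y) \<le> int m"
    using circ_same_coset[OF _ y eq] x w by simp
  ultimately have "circ (int (transl N)) (psi x - psi y) \<le> L * int ?l + int m"
    using circ_triangle[OF pos, of "psi x" "psi y" "psi (x \<otimes> w)"] by linarith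
  then have "real_of_int (circ (int (transl N)) (psi x - psi y)) \<le> real_of_int (L * int ?l + int m)"
    by (rule of_int_le_iff[THEN iffD2])
  then show ?thesis unfolding word_metric_coset[OF x y] by simp
qed

end

section \<open>Virtually cyclic groups act on the line\<close>

locale normal_infinite_cyclic = group G for G (structure) +
  fixes e :: "'a \<Rightarrow> int" and a :: 'a
  assumes a_closed [simp, intro]: "a \<in> carrier G"
    and inj_pow: "a [^] (y::int) = a [^] (z::int) \<Longrightarrow> y = z"
    and e_sign: "x \<in> carrier G \<Longrightarrow> e x = 1 \<or> e x = - 1"
    and conj_a: "x \<in> carrier G \<Longrightarrow> x \<otimes> a \<otimes> inv x = a [^] e x"
    and finite_index: "finite (rcosets (range (\<lambda>z::int. a [^] z)))"
begin

definition A where "A = range (\<lambda>z::int. a [^] z)"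

lemma A_subgroup: "subgroup A G"
proof (rule subgroupI)
  show "A \<subseteq> carrier G" "A \<noteq> {}" by (auto simp: A_def)
  show "inv x \<in> A" if xA: "x \<in> A" for x
  proof -
    obtain z :: int where "x = a [^] z" using xA by (auto simp: A_def)
    then have "inv x = a [^] (- z)" by (simp add: int_pow_neg)
    then show ?thesis by (auto simp: A_def)
  qed
  show "x \<otimes> y \<in> A" if xy: "x \<in> A" "y \<in> A" for x y
  proof -
    obtain z w :: int where "x = a [^] z" "y = a [^] w" using xy by (auto simp: A_def)
    then have "x \<otimes> y = a [^] (z + w)" by (simp add: int_pow_mult)
    then show ?thesis by (auto simp: A_def)
  qed
qed

lemma pow_in_A: "a [^] (z::int) \<in> A"
  by (auto simp: A_def)

lemma conj_a_pow: "x \<in> carrier G \<Longrightarrow> x \<otimes> a [^] (z::int) \<otimes> inv x = a [^] (e x * z)"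
  by (simp add: conj_int_pow conj_a int_pow_pow)

text \<open>Powers of \<open>a\<close> pass to the left at the cost of a sign; this is the source of
  the twist in \<open>psi_mult\<close>.\<close>

lemma move_a_pow:
  assumes "x \<in> carrier G" "y \<in> carrier G"
  shows "x \<otimes> (a [^] (z::int) \<otimes> y) = a [^] (e x * z) \<otimes> (x \<otimes> y)"
proof -
  have "a [^] (e x * z) \<otimes> (x \<otimes> y) = x \<otimes> a [^] z \<otimes> (inv x \<otimes> x) \<otimes> y"
    unfolding conj_a_pow[OF assms(1), symmetric]
    using assms m_assoc[of "inv x" x y, symmetric] by (simp add: m_assoc)
  then show ?thesis using assms by (simp add: m_assoc)
qed

lemma e_mult:
  assumes x: "x \<in> carrier G" and y: "y \<in> carrier G"
  shows "e (x \<otimes> y) = e x * e y"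
proof (rule inj_pow)
  have "a [^] e (x \<otimes> y) = x \<otimes> (y \<otimes> a \<otimes> inv y) \<otimes> inv x"
    using x y conj_a[of "x \<otimes> y"] by (simp add: inv_mult_group m_assoc)
  also have "\<dots> = a [^] (e x * e y)"
    unfolding conj_a[OF y] by (rule conj_a_pow[OF x])
  finally show "a [^] e (x \<otimes> y) = a [^] (e x * e y)" .
qed

lemma e_a_pow: "e (a [^] (z::int)) = 1"
proof (rule inj_pow)
  have "a [^] e (a [^] z) = a [^] z \<otimes> a [^] (1::int) \<otimes> a [^] (- z)"
    using conj_a[of "a [^] z"] by (simp add: int_pow_neg)
  also have "\<dots> = a [^] (1::int)"
    unfolding int_pow_mult[OF a_closed, symmetric] by simp
  finally show "a [^] e (a [^] z) = a [^] (1::int)" .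
qed

section \<open>Coset coordinates and the twisted transfer\<close>

definition rep :: "'a set \<Rightarrow> 'a" where "rep X = (SOME x. x \<in> carrier G \<and> A #> x = X)"

lemma rep:
  assumes "X \<in> rcosets A"
  shows "rep X \<in> carrier G" "A #> rep X = X"
proof -
  have "\<exists>x. x \<in> carrier G \<and> A #> x = X" using assms by (auto simp: RCOSETS_def)
  from someI_ex[OF this] show "rep X \<in> carrier G" "A #> rep X = X" by (auto simp: rep_def)
qed

lemma coset_closed: "x \<in> carrier G \<Longrightarrow> A #> x \<in> rcosets A"
  by (auto simp: RCOSETS_def)

text \<open>The coordinate of \<open>x\<close> along \<open>A\<close> with respect to the
  transversal \<open>rep\<close>; the exponent is unique by \<open>inj_pow\<close>.\<close>

definition zeta :: "'a \<Rightarrow> int" where "zeta x = (THE z. x = a [^] z \<otimes> rep (A #> x))"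

lemma zeta_unique:
  assumes "x \<in> carrier G" "x = a [^] (z::int) \<otimes> rep (A #> x)"
  shows "zeta x = z"
  unfolding zeta_def
proof (rule the_equality[where a = z])
  fix w :: int assume "x = a [^] w \<otimes> rep (A #> x)"
  then have "a [^] w \<otimes> rep (A #> x) = a [^] z \<otimes> rep (A #> x)" using assms(2) by metis
  then show "w = z" using rep[OF coset_closed[OF assms(1)]] by (intro inj_pow) simp
qed (rule assms(2))

lemma zeta:
  assumes x: "x \<in> carrier G"
  shows "x = a [^] zeta x \<otimes> rep (A #> x)"
proof -
  have "x \<in> A #> rep (A #> x)"
    using rep(2)[OF coset_closed[OF x]] rcos_self[OF x A_subgroup] by simp
  then obtain z where z: "x = a [^] (z::int) \<otimes> rep (A #> x)"
    by (auto simp: r_coset_def A_def)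
  show ?thesis unfolding zeta_unique[OF x z] by (rule z)
qed

lemma zeta_a_pow_mult:
  assumes x: "x \<in> carrier G"
  shows "zeta (a [^] (z::int) \<otimes> x) = z + zeta x"
proof (rule zeta_unique)
  have "A #> (a [^] z \<otimes> x) = A #> x" by (rule coset_absorb[OF A_subgroup pow_in_A x])
  moreover have "a [^] z \<otimes> x = a [^] z \<otimes> (a [^] zeta x \<otimes> rep (A #> x))"
    using zeta[OF x] by simp
  ultimately show "a [^] z \<otimes> x = a [^] (z + zeta x) \<otimes> rep (A #> (a [^] z \<otimes> x))"
    using rep(1)[OF coset_closed[OF x]] by (simp add: int_pow_mult m_assoc)
qed (use x in simp)

lemma zeta_rep:
  assumes X: "X \<in> rcosets A"
  shows "zeta (rep X) = 0"
  by (rule zeta_unique) (use rep[OF X] in auto)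

lemma finite_rcosets_A: "finite (rcosets A)"
  unfolding A_def by (rule finite_index)

text \<open>Left multiplication permutes right cosets because \<open>A\<close> is normal, here in
  the form of \<open>move_a_pow\<close>; by finiteness injectivity suffices.\<close>

lemma bij_rcosets:
  assumes h: "h \<in> carrier G"
  shows "bij_betw (\<lambda>X. A #> (h \<otimes> rep X)) (rcosets A) (rcosets A)"
proof -
  have "inj_on (\<lambda>X. A #> (h \<otimes> rep X)) (rcosets A)"
  proof (rule inj_onI)
    fix X Y assume X: "X \<in> rcosets A" and Y: "Y \<in> rcosets A"
      and eq: "A #> (h \<otimes> rep X) = A #> (h \<otimes> rep Y)"
    note r = rep(1)[OF X] rep(1)[OF Y]
    have "h \<otimes> rep X \<in> A #> (h \<otimes> rep Y)"
      unfolding eq[symmetric] using h r by (intro rcos_self[OF _ A_subgroup]) simp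
    then obtain z where z: "h \<otimes> rep X = a [^] (z::int) \<otimes> (h \<otimes> rep Y)"
      by (auto simp: r_coset_def A_def)
    have "rep X = inv h \<otimes> (h \<otimes> rep X)" using h r by (simp add: m_assoc[symmetric])
    also have "\<dots> = a [^] (e (inv h) * z) \<otimes> (inv h \<otimes> (h \<otimes> rep Y))"
      unfolding z using h r by (intro move_a_pow) auto
    also have "inv h \<otimes> (h \<otimes> rep Y) = rep Y" using h r by (simp add: m_assoc[symmetric])
    finally have "A #> rep X = A #> rep Y"
      using coset_absorb[OF A_subgroup pow_in_A r(2)] by simp
    then show "X = Y" using rep(2)[OF X] rep(2)[OF Y] by simp
  qed
  moreover have "(\<lambda>X. A #> (h \<otimes> rep X)) ` (rcosets A) \<subseteq> rcosets A"
    using h rep(1) coset_closed by auto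
  ultimately show ?thesis
    using endo_inj_surj[OF finite_rcosets_A] by (auto simp: bij_betw_def)
qed

text \<open>The twisted transfer: for \<open>e = 1\<close> this is the transfer homomorphism to \<open>A\<close>.\<close>

definition psi :: "'a \<Rightarrow> int" where "psi g = (\<Sum>X\<in>rcosets A. zeta (g \<otimes> rep X))"

text \<open>\<open>h \<otimes> rep X\<close> is a power of \<open>a\<close> times the representative
  of its coset. Moving that power past \<open>g\<close> produces the sign \<open>e g\<close>, and
  the remaining terms are those of \<open>psi g\<close>, permuted by
  \<open>bij_rcosets\<close>.\<close>

lemma psi_mult:
  assumes g: "g \<in> carrier G" and h: "h \<in> carrier G"
  shows "psi (g \<otimes> h) = psi g + e g * psi h"
proof -
  have "zeta (g \<otimes> h \<otimes> rep X)
      = e g * zeta (h \<otimes> rep X) + zeta (g \<otimes> rep (A #> (h \<otimes> rep X)))" if X: "X \<in> rcosets A" for X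
  proof -
    have hX: "h \<otimes> rep X \<in> carrier G" using h rep(1)[OF X] by simp
    note r = rep(1)[OF coset_closed[OF hX]]
    have "g \<otimes> h \<otimes> rep X = g \<otimes> (h \<otimes> rep X)" using g h rep(1)[OF X] by (simp add: m_assoc)
    also have "\<dots> = g \<otimes> (a [^] zeta (h \<otimes> rep X) \<otimes> rep (A #> (h \<otimes> rep X)))"
      using zeta[OF hX] by simp
    also have "\<dots> = a [^] (e g * zeta (h \<otimes> rep X)) \<otimes> (g \<otimes> rep (A #> (h \<otimes> rep X)))"
      by (rule move_a_pow[OF g r])
    finally show ?thesis using g r by (simp add: zeta_a_pow_mult)
  qed
  then have "psi (g \<otimes> h) = (\<Sum>X\<in>rcosets A. e g * zeta (h \<otimes> rep X))
      + (\<Sum>X\<in>rcosets A. zeta (g \<otimes> rep (A #> (h \<otimes> rep X))))"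
    unfolding psi_def by (simp add: sum.distrib)
  also have "(\<Sum>X\<in>rcosets A. zeta (g \<otimes> rep (A #> (h \<otimes> rep X)))) = psi g"
    unfolding psi_def by (rule sum.reindex_bij_betw[OF bij_rcosets[OF h]])
  finally show ?thesis by (simp add: psi_def sum_distrib_left)
qed

text \<open>Every coset contributes \<open>z\<close>; this is why the translation length of
  \<open>a\<close> is the index of \<open>A\<close>.\<close>

lemma psi_a_pow: "psi (a [^] (z::int)) = z * int (card (rcosets A))"
proof -
  have "zeta (a [^] z \<otimes> rep X) = z" if X: "X \<in> rcosets A" for X
    using zeta_a_pow_mult[OF rep(1)[OF X]] zeta_rep[OF X] by simp
  then show ?thesis unfolding psi_def by simp
qed

lemma line_action: "line_action G e psi a (card (rcosets A))"
proof
  show pos: "card (rcosets A) > 0"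
    using finite_rcosets_A coset_closed[OF one_closed] by (auto simp: card_gt_0_iff)
  show "e a = 1" using e_a_pow[of 1] by simp
  show "psi a = int (card (rcosets A))" using psi_a_pow[of 1] by simp
  \<comment> \<open>If \<open>psi x = 0\<close>, the coset of \<open>x\<close> determines
    \<open>zeta x\<close> and hence \<open>x\<close>, so each coset meets the stabilizer at most
    once.\<close>
  have "inj_on (\<lambda>x. A #> x) {x \<in> carrier G. psi x = 0}"
  proof (rule inj_onI)
    fix x y assume x: "x \<in> {x \<in> carrier G. psi x = 0}" and y: "y \<in> {x \<in> carrier G. psi x = 0}"
      and eq: "A #> x = A #> y"
    have *: "zeta z * int (card (rcosets A)) + psi (rep (A #> z)) = 0"
      if z: "z \<in> {x \<in> carrier G. psi x = 0}" for z
    proof -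
      have zG: "z \<in> carrier G" and "psi z = 0" using z by auto
      then have "psi (a [^] zeta z \<otimes> rep (A #> z)) = 0" using zeta[OF zG] by simp
      then show ?thesis
        using rep(1)[OF coset_closed[OF zG]] by (simp add: psi_mult psi_a_pow e_a_pow)
    qed
    have "zeta x * int (card (rcosets A)) = zeta y * int (card (rcosets A))"
      using *[OF x] *[OF y] unfolding eq by linarith
    then have "zeta x = zeta y" using pos by simp
    moreover have "x = a [^] zeta x \<otimes> rep (A #> x)" "y = a [^] zeta y \<otimes> rep (A #> y)"
      using zeta x y by auto
    ultimately show "x = y" unfolding eq by metis
  qed
  then show "finite {x \<in> carrier G. psi x = 0}"
    by (rule inj_on_finite[OF _ _ finite_rcosets_A]) (auto intro: coset_closed)
qed (auto simp: e_sign e_mult psi_mult conj_a)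

end

section \<open>From a cyclic subgroup of finite index to a normal one\<close>

context group
begin

text \<open>As \<open>H\<close> need not be normal, pigeonhole only gives an exponent between 1 and
  the index that depends on \<open>x\<close>; the factorial is a common multiple of all
  candidates.\<close>

lemma pow_fact_index:
  assumes H: "subgroup H G" and fin: "finite (rcosets H)" and x: "x \<in> carrier G"
  shows "x [^] (fact (card (rcosets H)) :: nat) \<in> H"
proof -
  interpret H: subgroup H G by fact
  let ?c = "card (rcosets H)" and ?f = "\<lambda>i::nat. H #> x [^] i"
  have "?f ` {0..?c} \<subseteq> rcosets H"
    by (intro image_subsetI rcosetsI[OF H.subset] nat_pow_closed x)
  then have "card (?f ` {0..?c}) \<le> ?c" by (rule card_mono[OF fin])
  then have "card (?f ` {0..?c}) < card {0..?c}" by simp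
  then have "\<not> inj_on ?f {0..?c}" by (rule pigeonhole)
  then obtain i j where "i \<le> ?c" "j \<le> ?c" "i \<noteq> j" "?f i = ?f j" by (auto simp: inj_on_def)
  then obtain i j where ij: "i < j" "j \<le> ?c" "?f i = ?f j" by (metis linorder_neqE_nat)
  have "x [^] j \<in> H #> x [^] i"
    unfolding ij(3) by (rule rcos_self[OF nat_pow_closed[OF x] H])
  then have "x [^] j \<otimes> inv (x [^] i) \<in> H"
    using H.rcos_module[OF is_group] x by simp
  moreover have "x [^] j \<otimes> inv (x [^] i) = x [^] (j - i)"
  proof -
    have "x [^] j = x [^] (j - i) \<otimes> x [^] i"
      unfolding nat_pow_mult[OF x] using ij(1) by simp
    then show ?thesis using x by (simp add: m_assoc)
  qed
  ultimately have d: "x [^] (j - i) \<in> H" by simp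
  have "(j - i) dvd fact ?c" by (rule dvd_fact) (use ij in auto)
  then obtain k where k: "fact ?c = (j - i) * k" by (auto elim: dvdE)
  have "(x [^] (j - i)) [^] k \<in> H" for k :: nat
    by (induction k) (use d in auto)
  then show ?thesis unfolding k nat_pow_pow[OF x, symmetric] .
qed

text \<open>Conjugation by \<open>g [^] n\<close> maps \<open>h [^] (q ^ n)\<close> to \<open>h [^] (i ^ n)\<close>; as \<open>g [^] q\<close> commutes with \<open>h\<close>, this forces \<open>i ^ q = q ^ q\<close>.\<close>

lemma conj_pow_pm:
  assumes h: "h \<in> carrier G" and inj: "\<And>y z. h [^] (y::int) = h [^] (z::int) \<Longrightarrow> y = z"
    and g: "g \<in> carrier G" and q: "q > 0"
    and comm: "g [^] (q::nat) \<in> range (\<lambda>z::int. h [^] z)"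
    and i: "g \<otimes> h [^] (int q) \<otimes> inv g = h [^] (i::int)"
  shows "i = int q \<or> i = - int q"
proof -
  have pow: "g [^] n \<otimes> h [^] (int q ^ n) \<otimes> inv (g [^] n) = h [^] (i ^ n)" for n
  proof (induction n)
    case 0
    then show ?case using h by simp
  next
    case (Suc n)
    have gn: "g [^] n \<in> carrier G" using g by simp
    have "g [^] Suc n \<otimes> h [^] (int q ^ Suc n) \<otimes> inv (g [^] Suc n)
        = g [^] n \<otimes> (g \<otimes> h [^] (int q * int q ^ n) \<otimes> inv g) \<otimes> inv (g [^] n)"
      using g h by (simp add: inv_mult_group m_assoc)
    also have "g \<otimes> h [^] (int q * int q ^ n) \<otimes> inv g = (h [^] (int q ^ n)) [^] i"
      unfolding int_pow_pow[OF h, symmetric] conj_int_pow[OF g int_pow_closed[OF h]] i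
      unfolding int_pow_pow[OF h] by (simp add: mult.commute)
    also have "g [^] n \<otimes> (h [^] (int q ^ n)) [^] i \<otimes> inv (g [^] n) = (h [^] (i ^ n)) [^] i"
      unfolding conj_int_pow[OF gn int_pow_closed[OF h]] Suc ..
    also have "\<dots> = h [^] (i ^ Suc n)"
      unfolding int_pow_pow[OF h] by (simp add: mult.commute)
    finally show ?case .
  qed
  obtain z :: int where z: "g [^] q = h [^] z" using comm by auto
  have "h [^] (i ^ q) = h [^] z \<otimes> h [^] (int q ^ q) \<otimes> h [^] (- z)"
    unfolding pow[symmetric] z int_pow_neg[OF h] ..
  also have "\<dots> = h [^] (int q ^ q)"
    unfolding int_pow_mult[OF h, symmetric] by simp
  finally have "i ^ q = int q ^ q" by (rule inj)
  then have "\<bar>i\<bar> ^ q = int q ^ q" by (metis abs_of_nat power_abs of_nat_power)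
  then have "\<bar>i\<bar> = int q" using q by (intro power_eq_imp_eq_base[of "\<bar>i\<bar>" q "int q"]) auto
  then show ?thesis by linarith
qed

lemma int_pow_inj_if_infinite:
  assumes h: "h \<in> carrier G" and inf: "infinite (range (\<lambda>z::int. h [^] z))"
    and eq: "h [^] (y::int) = h [^] (z::int)"
  shows "y = z"
proof (rule ccontr)
  assume "y \<noteq> z"
  moreover have "int (ord h) dvd z - y" using int_pow_eq[OF h] eq by blast
  ultimately have pos: "int (ord h) > 0" by (cases "ord h = 0") auto
  have "range (\<lambda>z::int. h [^] z) \<subseteq> (\<lambda>z::int. h [^] z) ` {0..<int (ord h)}"
  proof clarify
    fix w :: int
    have "h [^] w = h [^] (w mod int (ord h))"
      unfolding int_pow_eq[OF h] by (metis dvd_minus_mod dvd_minus_iff minus_diff_eq)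
    then show "h [^] w \<in> (\<lambda>z::int. h [^] z) ` {0..<int (ord h)}"
      using pos by (intro image_eqI[of _ _ "w mod int (ord h)"]) auto
  qed
  then show False using inf finite_surj[of "{0..<int (ord h)}"] by blast
qed

text \<open>The given cyclic subgroup generated by \<open>h\<close> need not be normal, but
  \<open>a = h [^] q\<close> generates a normal one when all \<open>q\<close>-th powers lie in
  \<open>H\<close>: a conjugate of \<open>a\<close> is then a power of \<open>h\<close>, and
  \<open>conj_pow_pm\<close> leaves only \<open>a\<close> and its inverse.\<close>

lemma virtually_cyclic_line_action:
  assumes inf: "infinite (carrier G)" and vc: "virtually_cyclic G"
  obtains e psi a m where "line_action G e psi a m"
proof -
  obtain H where H: "subgroup H G" and fin: "finite (rcosets H)"
    and cyc: "cyclic_group (G\<lparr>carrier := H\<rparr>)"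
    using vc by (auto simp: virtually_cyclic_def)
  interpret H: subgroup H G by fact
  obtain h where hH: "h \<in> H" and "H = range (\<lambda>n::int. h [^]\<^bsub>G\<lparr>carrier := H\<rparr>\<^esub> n)"
    using cyc group.cyclic_group[OF subgroup_imp_group[OF H]] by auto
  then have Hr: "H = range (\<lambda>n::int. h [^] n)"
    using int_pow_consistent[OF H hH] by simp
  have h: "h \<in> carrier G" using hH by simp
  have "infinite H"
  proof
    assume "finite H"
    then have "finite X" if "X \<in> rcosets H" for X
      using that by (auto simp: RCOSETS_def r_coset_def)
    then have "finite (\<Union>(rcosets H))" using fin by blast
    then show False using inf rcosets_part_G[OF H] by simp
  qed
  then have inj: "y = z" if "h [^] y = h [^] z" for y z :: int
    using int_pow_inj_if_infinite[OF h _ that] Hr by simp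
  define q :: nat where "q = fact (card (rcosets H))"
  have q: "q > 0" by (simp add: q_def)
  have powq: "x [^] q \<in> H" if "x \<in> carrier G" for x
    unfolding q_def by (rule pow_fact_index[OF H fin that])
  define a where "a = h [^] int q"
  have aG: "a \<in> carrier G" using h by (simp add: a_def)
  have a_pow: "a [^] z = h [^] (int q * z)" for z :: int
    unfolding a_def by (rule int_pow_pow[OF h])
  have conj: "x \<otimes> a \<otimes> inv x = a \<or> x \<otimes> a \<otimes> inv x = a [^] (- 1 :: int)"
    if x: "x \<in> carrier G" for x
  proof -
    have "x \<otimes> a \<otimes> inv x = (x \<otimes> h \<otimes> inv x) [^] q"
      unfolding a_def conj_int_pow[OF x h] by (rule int_pow_int)
    also have "\<dots> \<in> H" using x h by (intro powq) simp
    finally obtain i :: int where i: "x \<otimes> a \<otimes> inv x = h [^] i" using Hr by auto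
    have "i = int q \<or> i = - int q"
      using conj_pow_pm[OF h inj x q, of i] powq[OF x] i Hr unfolding a_def by blast
    then show ?thesis
      unfolding i a_pow by (auto simp: a_def)
  qed
  define e :: "'a \<Rightarrow> int" where "e x = (if x \<otimes> a \<otimes> inv x = a then 1 else - 1)" for x
  define A where "A = range (\<lambda>z::int. a [^] z)"
  have A_sub: "subgroup A G"
  proof -
    have "generate G {a} = A" unfolding A_def using generate_pow[OF aG] by auto
    then show ?thesis using generate_is_subgroup[of "{a}"] aG by simp
  qed
  \<comment> \<open>Each coset of \<open>H\<close> splits into at most \<open>q\<close> cosets of
    \<open>A\<close>, represented by \<open>h [^] i\<close> times a fixed element of it.\<close>
  have "rcosets A \<subseteq> (\<lambda>(i, X). A #> (h [^] i \<otimes> (SOME y. y \<in> X))) ` ({0..<int q} \<times> rcosets H)"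
  proof
    fix Y assume "Y \<in> rcosets A"
    then obtain x where x: "x \<in> carrier G" "Y = A #> x" by (auto simp: RCOSETS_def)
    define r where "r = (SOME y. y \<in> H #> x)"
    have "r \<in> H #> x" unfolding r_def using rcos_self[OF x(1) H] by (rule someI)
    moreover have "H #> x \<subseteq> carrier G" by (rule r_coset_subset_G[OF H.subset x(1)])
    ultimately have rG: "r \<in> carrier G" and rx: "H #> x = H #> r"
      using repr_independence[OF _ x(1) H] by blast+
    have "x \<in> H #> r" using rcos_self[OF x(1) H] rx by simp
    then obtain z :: int where z: "x = h [^] z \<otimes> r" using Hr by (auto simp: r_coset_def)
    have "h [^] z = a [^] (z div int q) \<otimes> h [^] (z mod int q)"
      unfolding a_pow int_pow_mult[OF h, symmetric] by simp
    then have "x = a [^] (z div int q) \<otimes> (h [^] (z mod int q) \<otimes> r)"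
      unfolding z using aG h rG by (simp add: m_assoc)
    moreover have "A #> (a [^] (z div int q) \<otimes> (h [^] (z mod int q) \<otimes> r))
        = A #> (h [^] (z mod int q) \<otimes> r)"
      by (rule coset_absorb[OF A_sub]) (use h rG in \<open>auto simp: A_def\<close>)
    ultimately have "Y = A #> (h [^] (z mod int q) \<otimes> r)" using x(2) by simp
    moreover have "z mod int q \<in> {0..<int q}" using q by simp
    moreover have "H #> x \<in> rcosets H" using x(1) by (auto simp: RCOSETS_def)
    ultimately show "Y \<in> (\<lambda>(i, X). A #> (h [^] i \<otimes> (SOME y. y \<in> X))) ` ({0..<int q} \<times> rcosets H)"
      unfolding r_def by (intro image_eqI[of _ _ "(z mod int q, H #> x)"]) auto
  qed
  then have finA: "finite (rcosets A)" by (rule finite_subset) (use fin in simp)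
  interpret normal_infinite_cyclic G e a
  proof
    show "y = z" if "a [^] y = a [^] z" for y z :: int
      using inj[of "int q * y" "int q * z"] that q unfolding a_pow by simp
    show "x \<otimes> a \<otimes> inv x = a [^] e x" if "x \<in> carrier G" for x
      using conj[OF that] aG by (auto simp: e_def)
  qed (use aG finA in \<open>auto simp: e_def A_def\<close>)
  show ?thesis using that line_action .
qed

end

section \<open>Finite quotients and cycles\<close>

definition rescale :: "nat \<Rightarrow> nat \<Rightarrow> int \<Rightarrow> nat" where
  "rescale k b i = nat ((i mod int k) * int b div int k)"

lemma rescale_bounds:
  assumes "k > 0"
  shows "int (rescale k b i) * int k \<le> (i mod int k) * int b"
    and "(i mod int k) * int b < int (rescale k b i) * int k + int k"
proof -
  have "0 \<le> (i mod int k) * int b div int k"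
    using assms by (simp add: pos_imp_zdiv_nonneg_iff)
  then have r: "int (rescale k b i) = (i mod int k) * int b div int k" by (simp add: rescale_def)
  have *: "(i mod int k) * int b = int k * int (rescale k b i) + (i mod int k) * int b mod int k"
    unfolding r by (rule mult_div_mod_eq[symmetric])
  moreover have "0 \<le> (i mod int k) * int b mod int k" "(i mod int k) * int b mod int k < int k"
    using assms by auto
  ultimately show "int (rescale k b i) * int k \<le> (i mod int k) * int b"
    and "(i mod int k) * int b < int (rescale k b i) * int k + int k"
    by (simp_all add: mult.commute)
qed

lemma rescale_less:
  assumes "k > 0" "b > 0"
  shows "rescale k b i < b"
proof -
  have "int (rescale k b i) * int k \<le> (i mod int k) * int b" by (rule rescale_bounds[OF assms(1)])
  also have "\<dots> < int k * int b"
    using assms by (intro mult_strict_right_mono) auto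
  finally have "int k * int (rescale k b i) < int k * int b" by (simp add: mult.commute)
  then show ?thesis using assms by simp
qed

text \<open>Clearing denominators, both terms have the form \<open>min t (k * b - t)\<close>, which
  is 1-Lipschitz in \<open>t\<close>. Here \<open>t\<close> is \<open>\<bar>p - q\<bar> * k\<close>
  or \<open>\<bar>i - j\<bar> * b\<close>, and rounding down \<open>p\<close> and \<open>q\<close>
  separates these by at most \<open>k\<close>.\<close>

lemma circ_rescale:
  assumes k: "k > 0" and b: "b > 0"
  shows "\<bar>circ (int b) (int (rescale k b x) - int (rescale k b y)) * int k
    - circ (int k) (x - y) * int b\<bar> \<le> int k"
proof -
  define i j where "i = x mod int k" and "j = y mod int k"
  define p q where "p = int (rescale k b x)" and "q = int (rescale k b y)"
  have ij: "0 \<le> i" "i < int k" "0 \<le> j" "j < int k" using k by (auto simp: i_def j_def)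
  have pq: "0 \<le> p" "p < int b" "0 \<le> q" "q < int b"
    using rescale_less[OF k b] by (auto simp: p_def q_def)
  have p: "p * int k \<le> i * int b" "i * int b < p * int k + int k"
    and q: "q * int k \<le> j * int b" "j * int b < q * int k + int k"
    using rescale_bounds[OF k] by (auto simp: p_def q_def i_def j_def)
  have "circ (int k) (x - y) = circ (int k) (i - j)"
    by (rule circ_cong) (simp add: i_def j_def mod_diff_eq)
  also have "\<dots> = min \<bar>i - j\<bar> (int k - \<bar>i - j\<bar>)" by (rule circ_diff_eq[OF ij])
  finally have "circ (int k) (x - y) * int b
      = min (\<bar>i - j\<bar> * int b) (int k * int b - \<bar>i - j\<bar> * int b)"
    by (simp add: min_mult_distrib_right left_diff_distrib)
  moreover have "circ (int b) (p - q) * int k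
      = min (\<bar>p - q\<bar> * int k) (int k * int b - \<bar>p - q\<bar> * int k)"
    unfolding circ_diff_eq[OF pq]
    by (simp add: min_mult_distrib_right left_diff_distrib mult.commute[of "int b"])
  moreover have "\<bar>\<bar>p - q\<bar> * int k - \<bar>i - j\<bar> * int b\<bar> \<le> int k"
  proof -
    have 1: "\<bar>p - q\<bar> * int k = \<bar>p * int k - q * int k\<bar>"
      by (simp add: abs_mult flip: left_diff_distrib)
    have 2: "\<bar>i - j\<bar> * int b = \<bar>i * int b - j * int b\<bar>"
      by (simp add: abs_mult flip: left_diff_distrib)
    show ?thesis unfolding 1 2 using p q by linarith
  qed
  ultimately show ?thesis unfolding p_def[symmetric] q_def[symmetric] by linarith
qed

text \<open>Scaling \<open>y\<close> back to \<open>y * k div b\<close> and forth again rounds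
  twice: the first rounding costs up to \<open>b / k \<le> c\<close>, the second up to 1.\<close>

lemma rescale_dense:
  assumes k: "k > 0" and b: "b > 0" and y: "y < b" and bk: "b \<le> c * k"
  shows "\<bar>int y - int (rescale k b (int (y * k div b)))\<bar> \<le> int c + 1"
proof -
  define i where "i = y * k div b"
  have "y * k < k * b" using y k by simp
  then have ik: "i < k" unfolding i_def using b by (simp add: less_mult_imp_div_less)
  have i: "i * b \<le> y * k" "y * k < i * b + b"
    unfolding i_def using b div_times_less_eq_dividend dividend_less_div_times by (auto simp: add.commute)
  define p where "p = int (rescale k b (int i))"
  have p: "p * int k \<le> int i * int b" "int i * int b < p * int k + int k"
    using rescale_bounds[OF k, where b = b and i = "int i"] ik by (simp_all add: p_def)
  have i': "int i * int b \<le> int y * int k" "int y * int k < int i * int b + int b"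
    using i by (simp_all flip: of_nat_mult of_nat_add)
  have "p * int k \<le> int y * int k" using p i' by linarith
  then have "p \<le> int y" using k by simp
  have bk': "int b \<le> int c * int k" using bk by (simp flip: of_nat_mult)
  have "int y * int k < (p + int c + 1) * int k"
    unfolding distrib_right using p i' bk' by linarith
  then have "int y < p + int c + 1" using k by (simp add: mult_less_cancel_right)
  then show ?thesis using \<open>p \<le> int y\<close> unfolding i_def[symmetric] p_def[symmetric] by linarith
qed

section \<open>Counting the normal subgroups and assembling the box space\<close>

context line_action
begin

lemma line_action_subgroupI:
  "N \<in> finite_index_normal_subgroups G \<Longrightarrow> line_action_subgroup G e psi a m N"
  unfolding finite_index_normal_subgroups_def
  by (intro line_action_subgroup.intro line_action_axioms line_action_subgroup_axioms.intro) auto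

text \<open>The window contains a translation of \<open>N\<close> by \<open>transl N\<close>, and
  its powers reduce \<open>psi\<close> on \<open>N\<close> to \<open>[0, transl N)\<close>. An
  orientation preserving element then has \<open>psi\<close> equal to 0, and a reflection occurs
  only if \<open>transl N \<le> 2 * m\<close>, so the reduced element is in the window too.\<close>

lemma normal_subgroup_determined:
  assumes N: "N \<in> finite_index_normal_subgroups G" and M: "M \<in> finite_index_normal_subgroups G"
    and sub: "N \<inter> {x \<in> carrier G. psi x \<in> insert (int (transl N)) {0..2 * int m}} \<subseteq> M"
  shows "N \<subseteq> M"
proof
  interpret N: line_action_subgroup G e psi a m N by (rule line_action_subgroupI[OF N])
  interpret M: line_action_subgroup G e psi a m M by (rule line_action_subgroupI[OF M])
  let ?k = "int (transl N)"
  obtain u where u: "u \<in> N" "e u = 1" "psi u = ?k" using N.transl_elem by blast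
  have uG: "u \<in> carrier G" using u by simp
  have uM: "u \<in> M" using sub u uG by blast
  fix x assume x: "x \<in> N"
  have xG: "x \<in> carrier G" using x by simp
  \<comment> \<open>Multiplying by \<open>u\<close> on the right lets \<open>x\<close> act on the
    displacement; the sign \<open>e x\<close> compensates for this.\<close>
  define z where "z = - e x * (psi x div ?k)"
  define y where "y = x \<otimes> u [^] z"
  have y: "y \<in> N" "y \<in> carrier G"
    unfolding y_def using x subgroup_int_pow_closed[OF N.is_subgroup u(1)] uG by auto
  have "psi y = psi x - (e x * e x) * (psi x div ?k * ?k)"
    unfolding y_def z_def using xG uG e_int_pow[OF uG u(2)] u(3) by (simp add: psi_mult)
  then have psi_y: "psi y = psi x mod ?k"
    unfolding e_square[OF xG] by (simp add: minus_div_mult_eq_mod)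
  have "psi y \<in> {0..2 * int m}"
  proof (cases "e x = 1")
    case True
    then have "psi y = 0" using N.transl_dvd[OF x] psi_y by simp
    then show ?thesis by simp
  next
    case False
    then have "transl N \<le> 2 * m" using N.transl_le_reflection[OF x] e_sign[OF xG] by blast
    moreover have "0 \<le> psi x mod ?k" "psi x mod ?k < ?k" using N.transl_pos by auto
    ultimately show ?thesis unfolding psi_y by auto
  qed
  then have "y \<in> M" using sub y by blast
  moreover have "x = y \<otimes> u [^] (- z)"
    unfolding y_def using xG uG by (simp add: m_assoc int_pow_mult[symmetric])
  ultimately show "x \<in> M" using subgroup_int_pow_closed[OF M.is_subgroup uM] by simp
qed

text \<open>Subgroups with the same \<open>k\<close> share the window \<open>D\<close> and are told
  apart by their traces on it, hence the power of 2. The window allows at most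
  \<open>2 * m + 2\<close> values of \<open>psi\<close>.\<close>

lemma finite_transl_level:
  "finite {N \<in> finite_index_normal_subgroups G. transl N = k} \<and>
   card {N \<in> finite_index_normal_subgroups G. transl N = k}
     \<le> 2 ^ ((2 * m + 2) * card {x \<in> carrier G. psi x = 0})"
proof -
  let ?I = "{N \<in> finite_index_normal_subgroups G. transl N = k}"
  define D where "D = {x \<in> carrier G. psi x \<in> insert (int k) {0..2 * int m}}"
  have finD: "finite D" unfolding D_def by (rule fibres) simp
  have "card D \<le> card (insert (int k) {0..2 * int m}) * card {x \<in> carrier G. psi x = 0}"
    unfolding D_def by (rule fibres) simp
  also have "\<dots> \<le> (2 * m + 2) * card {x \<in> carrier G. psi x = 0}"
    using card_insert_le_m1[of "2 * m + 2" "{0..2 * int m}" "int k"]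
    by (intro mult_le_mono1) (simp add: nat_add_distrib nat_mult_distrib)
  finally have cD: "card D \<le> (2 * m + 2) * card {x \<in> carrier G. psi x = 0}" .
  have inj: "inj_on (\<lambda>N. N \<inter> D) ?I"
  proof (rule inj_onI)
    fix N M assume N: "N \<in> ?I" and M: "M \<in> ?I" and eq: "N \<inter> D = M \<inter> D"
    have "N \<subseteq> M" by (rule normal_subgroup_determined) (use N M eq D_def in auto)
    moreover have "M \<subseteq> N" by (rule normal_subgroup_determined) (use N M eq D_def in auto)
    ultimately show "N = M" by blast
  qed
  have sub: "(\<lambda>N. N \<inter> D) ` ?I \<subseteq> Pow D" by blast
  have finP: "finite (Pow D)" using finD by simp
  have "card ?I \<le> card (Pow D)" by (rule card_inj_on_le[OF inj sub finP])
  also have "\<dots> = 2 ^ card D" using finD by (rule card_Pow)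
  also have "\<dots> \<le> 2 ^ ((2 * m + 2) * card {x \<in> carrier G. psi x = 0})"
    using cD by (intro power_increasing) auto
  finally show ?thesis using inj_on_finite[OF inj sub finP] by blast
qed

text \<open>The subgroups generated by \<open>a [^] j\<close> are the witnesses \<open>v\<close> for
  \<open>ex_rank_bijection\<close>.\<close>

definition translation_subgroup :: "nat \<Rightarrow> 'a set" where
  "translation_subgroup j = range (\<lambda>z::int. a [^] (int j * z))"

lemma translation_subgroup:
  assumes j: "j \<ge> 1"
  shows "translation_subgroup j \<in> finite_index_normal_subgroups G" "transl (translation_subgroup j) = m * j"
proof -
  have in_tr: "a [^] (int j * z) \<in> translation_subgroup j" for z by (auto simp: translation_subgroup_def)
  have sub: "subgroup (translation_subgroup j) G"
  proof (rule subgroupI)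
    show "translation_subgroup j \<subseteq> carrier G" "translation_subgroup j \<noteq> {}" by (auto simp: translation_subgroup_def)
    show "inv x \<in> translation_subgroup j" if x: "x \<in> translation_subgroup j" for x
    proof -
      obtain z where "x = a [^] (int j * z)" using x by (auto simp: translation_subgroup_def)
      then have "inv x = a [^] (int j * (- z))" by (simp add: int_pow_neg)
      then show ?thesis using in_tr by metis
    qed
    show "x \<otimes> y \<in> translation_subgroup j" if xy: "x \<in> translation_subgroup j" "y \<in> translation_subgroup j" for x y
    proof -
      obtain z w where "x = a [^] (int j * z)" "y = a [^] (int j * w)"
        using xy by (auto simp: translation_subgroup_def)
      then have "x \<otimes> y = a [^] (int j * (z + w))" by (simp add: int_pow_mult distrib_left)
      then show ?thesis using in_tr by metis
    qed
  qed
  moreover have "x \<otimes> h \<otimes> inv x \<in> translation_subgroup j" if x: "x \<in> carrier G" and h: "h \<in> translation_subgroup j" for x h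
  proof -
    obtain z where "h = a [^] (int j * z)" using h by (auto simp: translation_subgroup_def)
    then have "x \<otimes> h \<otimes> inv x = a [^] (int j * (e x * z))"
      using x by (simp add: conj_int_pow conj_a int_pow_pow mult.left_commute)
    then show ?thesis using in_tr by metis
  qed
  ultimately have normal: "translation_subgroup j \<lhd> G" unfolding normal_inv_iff by blast
  have u: "a [^] (int j * 1) \<in> translation_subgroup j" "e (a [^] (int j * 1)) = 1"
    "psi (a [^] (int j * 1)) = int (m * j)"
    using in_tr[of 1] e_a_pow psi_a_pow by auto
  moreover have pos: "m * j > 0" using m_pos j by simp
  ultimately have "finite (rcosets (translation_subgroup j))" by (intro finite_indexI[OF sub u(1,2)]) simp
  then show "translation_subgroup j \<in> finite_index_normal_subgroups G"
    using normal by (simp add: finite_index_normal_subgroups_def)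
  show "transl (translation_subgroup j) = m * j"
    unfolding transl_def
  proof (rule Least_equality)
    show "m * j > 0 \<and> (\<exists>x\<in>translation_subgroup j. e x = 1 \<and> psi x = int (m * j))" using pos u by blast
    fix k assume "k > 0 \<and> (\<exists>x\<in>translation_subgroup j. e x = 1 \<and> psi x = int k)"
    then obtain z where z: "psi (a [^] (int j * z)) = int k" "k > 0" by (auto simp: translation_subgroup_def)
    then have "int (m * j) dvd int k" unfolding psi_a_pow by (metis dvd_triv_left mult.commute mult.assoc of_nat_mult)
    then have "m * j dvd k" unfolding int_dvd_int_iff .
    then show "m * j \<le> k" using z(2) by (intro dvd_imp_le)
  qed
qed

text \<open>The map on \<open>G/N\<close> is \<open>psi\<close> of a chosen representative, rescaled
  from length \<open>transl N\<close> to length \<open>b N\<close>. Uniformity holds because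
  \<open>M\<close>, \<open>m\<close>, \<open>K1\<close> and \<open>K2\<close> do not depend on
  \<open>N\<close>.\<close>

lemma box_cycle_family:
  assumes S: "finite_generating_set G S"
  obtains b g L where "cycle_family (finite_index_normal_subgroups G) (\<lambda>N. carrier (G Mod N))
    (\<lambda>N. word_metric (G Mod N) ((\<lambda>s. N #> s) ` S)) b g L"
proof -
  let ?I = "finite_index_normal_subgroups G"
  let ?d = "\<lambda>N. word_metric (G Mod N) ((\<lambda>s. N #> s) ` S)"
  define M :: nat where "M = 2 ^ ((2 * m + 2) * card {x \<in> carrier G. psi x = 0})"
  have "\<exists>b. bij_betw b ?I {1..} \<and> (\<forall>N\<in>?I. b N \<le> M * transl N + M \<and> transl N \<le> m * b N)"
    by (rule ex_rank_bijection[where v = translation_subgroup])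
      (use finite_transl_level m_pos translation_subgroup in \<open>auto simp: M_def\<close>)
  then obtain b where b: "bij_betw b ?I {1..}"
    and b_le: "\<And>N. N \<in> ?I \<Longrightarrow> b N \<le> M * transl N + M"
    and transl_le: "\<And>N. N \<in> ?I \<Longrightarrow> transl N \<le> m * b N" by auto
  obtain K1 where K1: "K1 \<ge> 0" "\<And>g. g \<in> carrier G \<Longrightarrow> \<bar>psi g\<bar> \<le> K1 * int (word_length G S g)"
    using psi_le_word_length[OF S] by blast
  obtain K2 where K2: "K2 \<ge> 0" "\<And>g. g \<in> carrier G \<Longrightarrow> int (word_length G S g) \<le> K2 * \<bar>psi g\<bar> + K2"
    using word_length_le_psi[OF S] by blast
  define r where "r N X = (SOME x. x \<in> carrier G \<and> X = N #> x)" for N X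
  define g where "g N X = rescale (transl N) (b N) (psi (r N X))" for N X
  \<comment> \<open>The terms with \<open>K2\<close> bound the word metric by the cycle,
    \<open>2 * M * K1\<close> and \<open>2 * M * m + 1\<close> serve the converse, and
    \<open>4 * M * m + 2 * M + 2\<close> is the density constant.\<close>
  define L :: int where "L = K2 * int m + K2 + 2 * int M * K1 + 4 * int M * int m + 2 * int M + 2"
  have nonneg: "0 \<le> K2 * int m" "0 \<le> int M * K1" "0 \<le> int M * int m" using K1 K2 by auto
  have L0: "L \<ge> 0" using nonneg K1 K2 by (simp add: L_def)
  have "cycle_family ?I (\<lambda>N. carrier (G Mod N)) ?d b g (real_of_int L)"
    unfolding cycle_family_def
  proof (intro conjI b ballI)
    show "0 \<le> real_of_int L" using L0 by simp
    fix N assume N: "N \<in> ?I"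
    interpret N: line_action_subgroup G e psi a m N by (rule line_action_subgroupI[OF N])
    let ?k = "transl N"
    have bpos: "b N > 0" using bij_betwE[OF b] N by force
    have kpos: "?k > 0" by (rule N.transl_pos)
    \<comment> \<open>As \<open>transl N \<ge> 1\<close>, the additive \<open>M\<close> is absorbed
      into a purely linear bound.\<close>
    have "M * 1 \<le> M * ?k" using kpos by (intro mult_le_mono2) simp
    then have bk: "b N \<le> 2 * M * ?k" using b_le[OF N] by linarith
    have bk': "int (b N) \<le> 2 * int M * int ?k" "int ?k \<le> int m * int (b N)"
      using of_nat_mono[OF bk, where 'a = int] of_nat_mono[OF transl_le[OF N], where 'a = int] by simp_all
    have car: "carrier (G Mod N) = rcosets N" by (simp add: FactGroup_def)
    show "finite (carrier (G Mod N))" unfolding car by (rule N.fin_index)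
    show "carrier (G Mod N) \<noteq> {}" by (auto simp: carrier_FactGroup)
    show "g N \<in> carrier (G Mod N) \<rightarrow> {..<b N}"
      using rescale_less[OF kpos bpos] by (simp add: g_def)
    have r: "r N X \<in> carrier G" "N #> r N X = X" if X: "X \<in> carrier (G Mod N)" for X
    proof -
      have "\<exists>x. x \<in> carrier G \<and> X = N #> x" using X by (auto simp: carrier_FactGroup)
      from someI_ex[OF this] show "r N X \<in> carrier G" "N #> r N X = X"
        unfolding r_def by auto
    qed
    have circ_g: "circ (int (b N)) (int (rescale ?k (b N) x) - int (rescale ?k (b N) y))
        \<le> 2 * int M * circ (int ?k) (x - y) + 1" for x y
    proof -
      have c0: "0 \<le> circ (int ?k) (x - y)" using kpos by (intro circ_nonneg) simp
      have "circ (int (b N)) (int (rescale ?k (b N) x) - int (rescale ?k (b N) y)) * int ?k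
          \<le> circ (int ?k) (x - y) * int (b N) + int ?k"
        using circ_rescale[OF kpos bpos, of x y] by linarith
      also have "\<dots> \<le> circ (int ?k) (x - y) * (2 * int M * int ?k) + int ?k"
        using c0 bk' by (intro add_right_mono mult_left_mono) auto
      also have "\<dots> = (2 * int M * circ (int ?k) (x - y) + 1) * int ?k"
        by (simp add: algebra_simps)
      finally show ?thesis using kpos by simp
    qed
    have circ_k: "circ (int ?k) (x - y)
        \<le> int m * circ (int (b N)) (int (rescale ?k (b N) x) - int (rescale ?k (b N) y)) + int m" for x y
    proof -
      let ?c = "circ (int (b N)) (int (rescale ?k (b N) x) - int (rescale ?k (b N) y))"
      have c0: "0 \<le> ?c" using bpos by (intro circ_nonneg) simp
      have "circ (int ?k) (x - y) * int (b N) \<le> (?c + 1) * int ?k"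
        using circ_rescale[OF kpos bpos, of x y] unfolding distrib_right by linarith
      also have "\<dots> \<le> (?c + 1) * (int m * int (b N))"
        using c0 bk' by (intro mult_left_mono) auto
      also have "\<dots> = (int m * ?c + int m) * int (b N)" by (simp add: algebra_simps)
      finally show ?thesis using bpos by simp
    qed
    {
      fix X Y assume X: "X \<in> carrier (G Mod N)" and Y: "Y \<in> carrier (G Mod N)"
      note rX = r[OF X] and rY = r[OF Y]
      define c where "c = circ (int ?k) (psi (r N X) - psi (r N Y))"
      define w where "w = circ (int (b N)) (int (g N X) - int (g N Y))"
      have w0: "w \<ge> 0" unfolding w_def using bpos by (intro circ_nonneg) simp
      have cd: "cycle_dist (b N) (g N X) (g N Y) = real_of_int w" by (simp add: cycle_dist_def w_def)
      obtain l :: nat where l: "?d N X Y = real l" unfolding word_metric_def by blast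
      have "real l \<le> real_of_int (K2 * c + K2)"
        using N.word_metric_le_circ[OF S K2(2) rX(1) rY(1)] unfolding rX rY l c_def .
      then have l_le: "int l \<le> K2 * c + K2" by linarith
      have "K2 * c \<le> K2 * (int m * w + int m)"
        using circ_k[of "psi (r N X)" "psi (r N Y)"] K2(1) unfolding c_def w_def g_def
        by (rule mult_left_mono)
      then have "int l \<le> (K2 * int m) * w + (K2 * int m + K2)"
        using l_le by (simp add: algebra_simps)
      also have "\<dots> \<le> L * w + L"
        using w0 nonneg K1 K2 by (intro add_mono mult_right_mono) (simp_all add: L_def)
      finally have "real_of_int (int l) \<le> real_of_int (L * w + L)" by (rule of_int_le_iff[THEN iffD2])
      then show "?d N X Y \<le> real_of_int L * cycle_dist (b N) (g N X) (g N Y) + real_of_int L"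
        unfolding l cd by simp
      have "real_of_int c \<le> real_of_int K1 * real l + real m"
        using N.circ_le_word_metric[OF S K1(2,1) rX(1) rY(1)] unfolding rX rY l c_def .
      then have "real_of_int c \<le> real_of_int (K1 * int l + int m)" by simp
      then have "c \<le> K1 * int l + int m" unfolding of_int_le_iff .
      then have "2 * int M * c \<le> 2 * int M * (K1 * int l + int m)" by (intro mult_left_mono) auto
      then have "w \<le> (2 * int M * K1) * int l + (2 * int M * int m + 1)"
        using circ_g[of "psi (r N X)" "psi (r N Y)"] unfolding c_def w_def g_def
        by (simp add: algebra_simps)
      also have "\<dots> \<le> L * int l + L"
        using nonneg K1 K2 by (intro add_mono mult_right_mono) (simp_all add: L_def)
      finally have "real_of_int w \<le> real_of_int (L * int l + L)" by (rule of_int_le_iff[THEN iffD2])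
      then show "cycle_dist (b N) (g N X) (g N Y) \<le> real_of_int L * ?d N X Y + real_of_int L"
        unfolding l cd by simp
    }
    show "\<forall>y<b N. \<exists>X\<in>carrier (G Mod N). cycle_dist (b N) y (g N X) \<le> real_of_int L"
    proof (intro allI impI)
      fix y assume y: "y < b N"
      define i where "i = int (y * ?k div b N)"
      \<comment> \<open>\<open>psi\<close> need not be onto, but the powers of \<open>a\<close>
        reach within \<open>m\<close> of every integer.\<close>
      define X where "X = N #> a [^] (i div int m)"
      have X: "X \<in> carrier (G Mod N)" unfolding X_def carrier_FactGroup by auto
      have kp: "int ?k > 0" and bp: "int (b N) > 0" using kpos bpos by auto
      have "\<bar>i - i div int m * int m\<bar> = i mod int m"
        using m_pos by (simp add: minus_div_mult_eq_mod)
      also have "\<dots> \<le> int m" using m_pos by (simp add: order_less_imp_le)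
      finally have "circ (int ?k) (i - psi (a [^] (i div int m))) \<le> int m"
        unfolding psi_a_pow using circ_le_abs[OF kp] order_trans by blast
      moreover have "circ (int ?k) (psi (a [^] (i div int m)) - psi (r N X)) \<le> int m"
        by (rule N.circ_same_coset) (use r[OF X] in \<open>simp_all add: X_def\<close>)
      ultimately have "circ (int ?k) (i - psi (r N X)) \<le> 2 * int m"
        using circ_triangle[OF kp, of i "psi (r N X)" "psi (a [^] (i div int m))"] by linarith
      then have "2 * int M * circ (int ?k) (i - psi (r N X)) \<le> 2 * int M * (2 * int m)"
        by (intro mult_left_mono) auto
      then have "circ (int (b N)) (int (rescale ?k (b N) i) - int (g N X)) \<le> 4 * int M * int m + 1"
        using circ_g[of i "psi (r N X)"] unfolding g_def by linarith
      moreover have "circ (int (b N)) (int y - int (rescale ?k (b N) i)) \<le> 2 * int M + 1"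
        using rescale_dense[OF kpos bpos y bk] circ_le_abs[OF bp, of "int y - int (rescale ?k (b N) i)"]
        unfolding i_def by simp
      ultimately have "circ (int (b N)) (int y - int (g N X)) \<le> 4 * int M * int m + 2 * int M + 2"
        using circ_triangle[OF bp, of "int y" "int (g N X)" "int (rescale ?k (b N) i)"] by linarith
      also have "\<dots> \<le> L" using nonneg K1 K2 by (simp add: L_def)
      finally show "\<exists>X\<in>carrier (G Mod N). cycle_dist (b N) y (g N X) \<le> real_of_int L"
        using X unfolding cycle_dist_def by (intro bexI[of _ X]) simp_all
    qed
  qed
  then show ?thesis by (rule that)
qed

end

section \<open>Comparison of the box spaces with each other and with the cycles\<close>

lemma box_space_cycle_family:
  assumes G: "group G" and inf: "infinite (carrier G)" and vc: "virtually_cyclic G"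
    and S: "finite_generating_set G S"
  obtains b g L where "cycle_family (finite_index_normal_subgroups G) (\<lambda>N. carrier (G Mod N))
    (\<lambda>N. word_metric (G Mod N) ((\<lambda>s. N #>\<^bsub>G\<^esub> s) ` S)) b g L"
proof -
  obtain e psi a m where act: "line_action G e psi a m"
    by (rule group.virtually_cyclic_line_action[OF G inf vc])
  show ?thesis
    by (rule line_action.box_cycle_family[OF act S]) (rule that)
qed

lemma virtually_cyclic_integer_group: "virtually_cyclic integer_group"
proof -
  interpret group integer_group by simp
  have "carrier integer_group #>\<^bsub>integer_group\<^esub> x = carrier integer_group" for x
    by (rule coset_join2[OF _ subgroup_self]) simp_all
  then have "rcosets\<^bsub>integer_group\<^esub> (carrier integer_group) \<subseteq> {carrier integer_group}"
    unfolding RCOSETS_def by blast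
  then have "finite (rcosets\<^bsub>integer_group\<^esub> (carrier integer_group))"
    by (rule finite_subset) simp
  moreover have "integer_group\<lparr>carrier := carrier integer_group\<rparr> = integer_group"
    by (simp add: integer_group_def)
  ultimately show ?thesis
    unfolding virtually_cyclic_def using subgroup_self cyclic_integer_group by metis
qed

theorem theorem5:
  fixes G :: "('a, 'b) monoid_scheme"
    and S :: "'a set"
    and boxG :: "('a set \<times> 'a set) metric"
  assumes "group G"
    and "infinite (carrier G)"
    and "virtually_cyclic G"
    and "finite_generating_set G S"
    and "full_box_space G S boxG"
  shows "(\<forall>T boxZ. finite_generating_set integer_group T \<and> full_box_space integer_group T boxZ \<longrightarrow>
            coarsely_equivalent boxG boxZ) \<and>
         (\<forall>C. union_of_cycles C \<longrightarrow> coarsely_equivalent boxG C)"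
proof (intro conjI allI impI)
  obtain b g L where F: "cycle_family (finite_index_normal_subgroups G) (\<lambda>N. carrier (G Mod N))
      (\<lambda>N. word_metric (G Mod N) ((\<lambda>s. N #>\<^bsub>G\<^esub> s) ` S)) b g L"
    using box_space_cycle_family[OF assms(1-4)] .
  note boxG = assms(5)[unfolded full_box_space_def]
  show "coarsely_equivalent boxG C" if "union_of_cycles C" for C
    using coarsely_equivalent_cycle_families[OF F cycle_family_cycles boxG]
      that[unfolded union_of_cycles_def] .
  fix T boxZ
  assume T: "finite_generating_set integer_group T \<and> full_box_space integer_group T boxZ"
  \<comment> \<open>The integers enter as another infinite virtually cyclic group; the two box
    spaces are then matched through cycles of equal length.\<close>
  obtain b' g' L' where F': "cycle_family (finite_index_normal_subgroups integer_group)
      (\<lambda>N. carrier (integer_group Mod N))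
      (\<lambda>N. word_metric (integer_group Mod N) ((\<lambda>s. N #>\<^bsub>integer_group\<^esub> s) ` T)) b' g' L'"
    using box_space_cycle_family[OF group_integer_group _ virtually_cyclic_integer_group, of T] T
    by (auto simp: infinite_UNIV_int)
  show "coarsely_equivalent boxG boxZ"
    using coarsely_equivalent_cycle_families[OF F F' boxG] T[unfolded full_box_space_def] by blast
qed

end
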